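(* Let $\Bbbk$ be a field. (1) There exists a monomial ideal (in some polynomial ring over $\Bbbk$) whose hull resolution does not admit a DGA structure. (2) There exists a monomial ideal, together with a total order on its minimal monomial generators, whose Lyubeznik resolution with respect to this order does not admit a DGA structure. (3) There exists a monomial ideal whose minimal free resolution is supported on a simplicial complex (and in particular is cellular), but which does not admit a DGA structure on its minimal free resolution.
   Context: Let $S=\Bbbk[x_1,\dots,x_n]$ with the fine $\mathbb{Z}^n$-grading, $I\subsetneq S$ a monomial ideal and $G(I)$ its set of minimal monomial generators. DGA structures. Let $\mathbb{F}$ be a $\mathbb{Z}^n$-graded free resolution of $S/I$ with $\mathbb{F}_0=S$ and differential $\partial$, identified with $\bigoplus_i\mathbb{F}_i$; $|f|$ is the homological degree. A DGA structure on $\mathbb{F}$ is an $S$-linear map $*:\mathbb{F}\otimes_S\mathbb{F}\to\mathbb{F}$ respecting the $\mathbb{Z}^n$-grading, such that for all (homogeneous) $a,b,c$: (1) $*$ extends the usual multiplication on $\mathbb{F}_0=S$ and $1\in\mathbb{F}_0$ acts as the identity; (2) $\partial(a*b)=\partial(a)*b+(-1)^{|a|}a*\partial(b)$; (3) $|a*b|=|a|+|b|$; (4) $a*b=(-1)^{|a||b|}b*a$; (5) $(a*b)*c=a*(b*c)$. Cellular resolutions. Let $X$ be a polyhedral cell complex (e.g. a simplicial complex), including the empty face, whose vertices are labelled by monomials; label each face $F$ by the least common multiple $m_F$ of the labels of its vertices ($m_\emptyset=1$). The associated cellular complex is the complex of free $S$-modules with basis $\{e_F: F\in X\}$, where $e_F$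 has homological degree $\dim F+1$ and multidegree $\deg m_F$, and differential $\partial e_F=\sum_{G}\varepsilon(F,G)\frac{m_F}{m_G}e_G$, the sum being over the facets $G$ of $F$ and $\varepsilon(F,G)\in\{\pm1\}$ the incidence signs of $X$. A free resolution of $S/I$ is supported on $X$ (and called cellular) if it is isomorphic to the cellular complex of $X$, with vertices labelled by generators of $I$. Hull resolution. For a real number $t>(n+1)!$ let $P_t\subset\mathbb{R}^n$ be the convex hull of $\{(t^{a_1},\dots,t^{a_n}) : x_1^{a_1}\cdots x_n^{a_n}\in I\}$. Its vertices are the points $(t^{a_1},\dots,t^{a_n})$ with $x^{\mathbf a}\in G(I)$, and its face poset does not depend on $t$. The hull complex is the polyhedral cell complex of bounded faces of $P_t$, with the vertex $(t^{a_1},\dots,t^{a_n})$ labelled by $x^{\mathbf{a}}$; the associated cellular complex is a free resolution of $S/I$, the hull resolution. Lyubeznik resolution. Fix a total order $\prec$ on $G(I)$. The Lyubeznik complex is the simplicial complex on $G(I)$ whose faces are the sets $W=\{m_1\prec\cdots\prec m_s\}\subseteq G(I)$ such that for no $1\le t\le s$ there exists $q\in G(I)$ with $q\prec m_t$ and $q\mid\operatorname{lcm}(m_t,m_{t+1},\dots,m_s)$. The cellular complex it supports (each vertex labelled by itself) is a free resolution of $S/I$, the Lyubeznik resolution with respect to $\prec$. *)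

theory Defs
  imports "HOL-Analysis.Analysis" "HOL-Library.Function_Algebras" "HOL-Library.Poly_Mapping"
begin

section \<open>Polynomials and monomial ideals\<close>

text \<open>Exponent vectors are finitely supported functions on the variable indices, and
  \<open>S = k[x\<^sub>0, \<dots>, x\<^sub>n\<^sub>-\<^sub>1]\<close> is the set of polynomials in which only variables with index
  below \<open>n\<close> occur; this lets \<open>n\<close> be quantified over.\<close>

type_synonym expo = "nat \<Rightarrow>\<^sub>0 nat"
type_synonym 'k mpoly = "expo \<Rightarrow>\<^sub>0 'k"

definition exps :: "nat \<Rightarrow> expo set" where
  "exps n = {a. Poly_Mapping.keys a \<subseteq> {..<n}}"

definition polys :: "nat \<Rightarrow> 'k::zero mpoly set" where
  "polys n = {p. Poly_Mapping.keys p \<subseteq> exps n}"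

definition mon :: "expo \<Rightarrow> 'k::zero_neq_one mpoly" where
  "mon a = Poly_Mapping.single a 1"

text \<open>The order that the library puts on finitely supported functions is not divisibility
  of monomials.\<close>

definition mdvd :: "expo \<Rightarrow> expo \<Rightarrow> bool" where
  "mdvd a b \<longleftrightarrow> (\<forall>i. Poly_Mapping.lookup a i \<le> Poly_Mapping.lookup b i)"

text \<open>Least common multiple of a finite set of monomials.\<close>

definition mlcm :: "expo set \<Rightarrow> expo" where
  "mlcm A = Abs_poly_mapping (\<lambda>i. Max (insert 0 ((\<lambda>a. Poly_Mapping.lookup a i) ` A)))"

lemma lookup_mlcm:
  assumes "finite A"
  shows "Poly_Mapping.lookup (mlcm A) i = Max (insert 0 ((\<lambda>a. Poly_Mapping.lookup a i) ` A))"
proof -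
  have "{i. Max (insert 0 ((\<lambda>a. Poly_Mapping.lookup a i) ` A)) \<noteq> 0} \<subseteq> (\<Union>a\<in>A. Poly_Mapping.keys a)"
  proof
    fix i assume "i \<in> {i. Max (insert 0 ((\<lambda>a. Poly_Mapping.lookup a i) ` A)) \<noteq> 0}"
    moreover have "Max (insert 0 ((\<lambda>a. Poly_Mapping.lookup a i) ` A)) \<in> insert 0 ((\<lambda>a. Poly_Mapping.lookup a i) ` A)"
      using assms by (intro Max_in) auto
    ultimately show "i \<in> (\<Union>a\<in>A. Poly_Mapping.keys a)" by (auto simp: in_keys_iff)
  qed
  then have "finite {i. Max (insert 0 ((\<lambda>a. Poly_Mapping.lookup a i) ` A)) \<noteq> 0}"
    by (rule finite_subset) (simp add: assms)
  then show ?thesis unfolding mlcm_def by (subst Abs_poly_mapping_inverse) simp_all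
qed

definition ideal_of :: "nat \<Rightarrow> expo set \<Rightarrow> 'k::comm_ring_1 mpoly set" where
  "ideal_of n A = {(\<Sum>a\<in>B. q a * mon a) | B q. finite B \<and> B \<subseteq> A \<and> (\<forall>a\<in>B. q a \<in> polys n)}"

definition monomial_ideal :: "nat \<Rightarrow> 'k::comm_ring_1 mpoly set \<Rightarrow> bool" where
  "monomial_ideal n I \<longleftrightarrow> (\<exists>A \<subseteq> exps n. I = ideal_of n A) \<and> I \<noteq> polys n"

definition mingens :: "nat \<Rightarrow> 'k::comm_ring_1 mpoly set \<Rightarrow> expo set" where
  "mingens n I = {a \<in> exps n. mon a \<in> I \<and> (\<forall>b \<in> exps n. mon b \<in> I \<and> mdvd b a \<longrightarrow> b = a)}"

definition max_ideal :: "nat \<Rightarrow> 'k::comm_ring_1 mpoly set" where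
  "max_ideal n = ideal_of n {Poly_Mapping.single i 1 | i. i < n}"

section \<open>Graded complexes of free modules and DGA structures\<close>

text \<open>A complex of finitely generated \<open>\<int>\<^sup>n\<close>-graded free modules, all homological degrees
  taken together: \<open>hdeg\<close> and \<open>mdeg\<close> give the homological degree and the multidegree of the
  basis elements, and \<open>dmat F b c\<close> is the coefficient of \<open>c\<close> in \<open>\<partial> b\<close>. The identification of
  the degree-0 part with \<open>S\<close> sends the basis element \<open>unit_el\<close> to \<open>1\<close>. Elements of the module
  are functions from the basis to \<open>S\<close>, extended by \<open>0\<close>; addition is pointwise.\<close>

record (overloaded) ('b, 'k) graded_complex =
  basis :: "'b set"
  hdeg :: "'b \<Rightarrow> nat"
  mdeg :: "'b \<Rightarrow> nat \<Rightarrow> int"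
  dmat :: "'b \<Rightarrow> 'b \<Rightarrow> 'k mpoly"
  unit_el :: 'b

definition total_module :: "nat \<Rightarrow> ('b, 'k::comm_ring_1) graded_complex \<Rightarrow> ('b \<Rightarrow> 'k mpoly) set" where
  "total_module n F = {f. (\<forall>b \<in> basis F. f b \<in> polys n) \<and> (\<forall>b. b \<notin> basis F \<longrightarrow> f b = 0)}"

definition hpart :: "nat \<Rightarrow> ('b, 'k::comm_ring_1) graded_complex \<Rightarrow> nat \<Rightarrow> ('b \<Rightarrow> 'k mpoly) set" where
  "hpart n F i = {f \<in> total_module n F. \<forall>b. f b \<noteq> 0 \<longrightarrow> hdeg F b = i}"

definition homogeneous :: "('b, 'k::comm_ring_1) graded_complex \<Rightarrow> (nat \<Rightarrow> int) \<Rightarrow> ('b \<Rightarrow> 'k mpoly) \<Rightarrow> bool" where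
  "homogeneous F d f \<longleftrightarrow> (\<forall>b. \<forall>m \<in> Poly_Mapping.keys (f b). d = (\<lambda>i. int (Poly_Mapping.lookup m i)) + mdeg F b)"

definition smul :: "'k::comm_ring_1 mpoly \<Rightarrow> ('b \<Rightarrow> 'k mpoly) \<Rightarrow> 'b \<Rightarrow> 'k mpoly" where
  "smul s f = (\<lambda>b. s * f b)"

definition bd :: "('b, 'k::comm_ring_1) graded_complex \<Rightarrow> ('b \<Rightarrow> 'k mpoly) \<Rightarrow> 'b \<Rightarrow> 'k mpoly" where
  "bd F f = (\<lambda>c. if c \<in> basis F then \<Sum>b \<in> basis F. f b * dmat F b c else 0)"

definition one_el :: "('b, 'k::comm_ring_1) graded_complex \<Rightarrow> 'b \<Rightarrow> 'k mpoly" where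
  "one_el F = (\<lambda>b. if b = unit_el F then 1 else 0)"

definition dga_structure :: "nat \<Rightarrow> ('b, 'k::comm_ring_1) graded_complex
    \<Rightarrow> (('b \<Rightarrow> 'k mpoly) \<Rightarrow> ('b \<Rightarrow> 'k mpoly) \<Rightarrow> 'b \<Rightarrow> 'k mpoly) \<Rightarrow> bool" where
  "dga_structure n F mul \<longleftrightarrow> (let M = total_module n F in
     (\<forall>f\<in>M. \<forall>g\<in>M. mul f g \<in> M) \<and>
     (\<forall>f\<in>M. \<forall>g\<in>M. \<forall>h\<in>M. mul (f + g) h = mul f h + mul g h \<and> mul h (f + g) = mul h f + mul h g) \<and>
     (\<forall>s\<in>polys n. \<forall>f\<in>M. \<forall>g\<in>M. mul (smul s f) g = smul s (mul f g) \<and> mul f (smul s g) = smul s (mul f g)) \<and>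
     (\<forall>d e. \<forall>f\<in>M. \<forall>g\<in>M. homogeneous F d f \<and> homogeneous F e g \<longrightarrow> homogeneous F (d + e) (mul f g)) \<and>
     (\<forall>s\<in>polys n. \<forall>s'\<in>polys n.
        mul (smul s (one_el F)) (smul s' (one_el F)) = smul (s * s') (one_el F)) \<and>
     (\<forall>f\<in>M. mul (one_el F) f = f \<and> mul f (one_el F) = f) \<and>
     (\<forall>i. \<forall>f \<in> hpart n F i. \<forall>g\<in>M. bd F (mul f g) = mul (bd F f) g + smul ((-1) ^ i) (mul f (bd F g))) \<and>
     (\<forall>i j. \<forall>f \<in> hpart n F i. \<forall>g \<in> hpart n F j. mul f g \<in> hpart n F (i + j)) \<and>
     (\<forall>i j. \<forall>f \<in> hpart n F i. \<forall>g \<in> hpart n F j. mul f g = smul ((-1) ^ (i * j)) (mul g f)) \<and>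
     (\<forall>f\<in>M. \<forall>g\<in>M. \<forall>h\<in>M. mul (mul f g) h = mul f (mul g h)))"

definition admits_dga :: "nat \<Rightarrow> ('b, 'k::comm_ring_1) graded_complex \<Rightarrow> bool" where
  "admits_dga n F \<longleftrightarrow> (\<exists>mul. dga_structure n F mul)"

definition free_complex :: "nat \<Rightarrow> ('b, 'k::comm_ring_1) graded_complex \<Rightarrow> bool" where
  "free_complex n F \<longleftrightarrow>
     finite (basis F) \<and>
     (\<forall>b \<in> basis F. \<forall>i \<ge> n. mdeg F b i = 0) \<and>
     (\<forall>b \<in> basis F. \<forall>c \<in> basis F. dmat F b c \<in> polys n \<and>
        (dmat F b c \<noteq> 0 \<longrightarrow> hdeg F b = Suc (hdeg F c)) \<and>
        (\<forall>m \<in> Poly_Mapping.keys (dmat F b c). mdeg F b = (\<lambda>i. int (Poly_Mapping.lookup m i)) + mdeg F c)) \<and>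
     (\<forall>f \<in> total_module n F. bd F (bd F f) = 0)"

definition free_resolution :: "nat \<Rightarrow> 'k::comm_ring_1 mpoly set \<Rightarrow> ('b, 'k) graded_complex \<Rightarrow> bool" where
  "free_resolution n I F \<longleftrightarrow>
     free_complex n F \<and>
     {b \<in> basis F. hdeg F b = 0} = {unit_el F} \<and> mdeg F (unit_el F) = 0 \<and>
     {bd F f (unit_el F) | f. f \<in> hpart n F 1} = I \<and>
     (\<forall>i \<ge> 1. \<forall>f \<in> hpart n F i. bd F f = 0 \<longrightarrow> (\<exists>g \<in> hpart n F (Suc i). bd F g = f))"

definition minimal_free_resolution :: "nat \<Rightarrow> 'k::comm_ring_1 mpoly set \<Rightarrow> ('b, 'k) graded_complex \<Rightarrow> bool" where
  "minimal_free_resolution n I F \<longleftrightarrow> free_resolution n I F \<and>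
     (\<forall>b \<in> basis F. \<forall>c \<in> basis F. dmat F b c \<in> max_ideal n)"

definition graded_iso :: "nat \<Rightarrow> ('b, 'k::comm_ring_1) graded_complex \<Rightarrow> ('c, 'k) graded_complex
    \<Rightarrow> (('b \<Rightarrow> 'k mpoly) \<Rightarrow> 'c \<Rightarrow> 'k mpoly) \<Rightarrow> bool" where
  "graded_iso n F G \<phi> \<longleftrightarrow>
     bij_betw \<phi> (total_module n F) (total_module n G) \<and>
     (\<forall>f \<in> total_module n F. \<forall>g \<in> total_module n F. \<phi> (f + g) = \<phi> f + \<phi> g) \<and>
     (\<forall>s \<in> polys n. \<forall>f \<in> total_module n F. \<phi> (smul s f) = smul s (\<phi> f)) \<and>
     (\<forall>i. \<forall>f \<in> hpart n F i. \<phi> f \<in> hpart n G i) \<and>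
     (\<forall>d. \<forall>f \<in> total_module n F. homogeneous F d f \<longrightarrow> homogeneous G d (\<phi> f)) \<and>
     (\<forall>f \<in> total_module n F. \<phi> (bd F f) = bd G (\<phi> f))"

section \<open>Labelled cell complexes and cellular complexes\<close>

text \<open>A cell is a set of points and the face relation is inclusion. For a polyhedral complex the
  points are those of the ambient space, for a simplicial complex they are the abstract vertices;
  in both cases the vertices are the points \<open>v\<close> such that \<open>{v}\<close> is a cell, and the empty set
  is a cell. The rank of a cell is its dimension plus one.\<close>

record 'v labelled_complex =
  cells :: "'v set set"
  rank :: "'v set \<Rightarrow> nat"
  label :: "'v \<Rightarrow> expo"

definition vertices :: "'v labelled_complex \<Rightarrow> 'v set" where
  "vertices X = {v. {v} \<in> cells X}"

definition cell_label :: "'v labelled_complex \<Rightarrow> 'v set \<Rightarrow> expo" where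
  "cell_label X C = mlcm (label X ` (C \<inter> vertices X))"

definition facet_in :: "'v labelled_complex \<Rightarrow> 'v set \<Rightarrow> 'v set \<Rightarrow> bool" where
  "facet_in X D C \<longleftrightarrow> D \<in> cells X \<and> C \<in> cells X \<and> D \<subseteq> C \<and> rank X C = Suc (rank X D)"

text \<open>The incidence signs of a cell complex are determined up to a choice of orientations of the
  cells; the possible choices are exactly the functions satisfying the usual axioms of an incidence
  function. In the last axiom the sum has two summands when \<open>X\<close> is polyhedral.\<close>

definition incidence_function :: "'v labelled_complex \<Rightarrow> ('v set \<Rightarrow> 'v set \<Rightarrow> int) \<Rightarrow> bool" where
  "incidence_function X \<epsilon> \<longleftrightarrow>
     (\<forall>C D. facet_in X D C \<longrightarrow> \<epsilon> C D \<in> {1, -1}) \<and>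
     (\<forall>v \<in> vertices X. \<epsilon> {v} {} = 1) \<and>
     (\<forall>C \<in> cells X. \<forall>E \<in> cells X. E \<subseteq> C \<and> rank X C = rank X E + 2 \<longrightarrow>
        (\<Sum>D | facet_in X D C \<and> facet_in X E D. \<epsilon> C D * \<epsilon> D E) = 0)"

definition cellular_complex :: "'v labelled_complex \<Rightarrow> ('v set \<Rightarrow> 'v set \<Rightarrow> int)
    \<Rightarrow> ('v set, 'k::comm_ring_1) graded_complex" where
  "cellular_complex X \<epsilon> =
     \<lparr> basis = cells X,
       hdeg = rank X,
       mdeg = (\<lambda>C i. int (Poly_Mapping.lookup (cell_label X C) i)),
       dmat = (\<lambda>C D. if facet_in X D C
                then Poly_Mapping.single (cell_label X C - cell_label X D) (of_int (\<epsilon> C D)) else 0),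
       unit_el = {} \<rparr>"

text \<open>The resolution \<open>F\<close> of \<open>S/I\<close> is supported on \<open>X\<close>.\<close>

definition supported_on :: "nat \<Rightarrow> 'k::comm_ring_1 mpoly set \<Rightarrow> ('b, 'k) graded_complex
    \<Rightarrow> 'v labelled_complex \<Rightarrow> bool" where
  "supported_on n I F X \<longleftrightarrow>
     label X ` vertices X \<subseteq> exps n \<and> ideal_of n (label X ` vertices X) = I \<and>
     (\<exists>\<epsilon> \<phi>. incidence_function X \<epsilon> \<and> graded_iso n F (cellular_complex X \<epsilon>) \<phi>)"

definition abstract_simplicial_complex :: "'v set set \<Rightarrow> bool" where
  "abstract_simplicial_complex K \<longleftrightarrow> finite K \<and> {} \<in> K \<and> (\<forall>W \<in> K. finite W \<and> (\<forall>V \<subseteq> W. V \<in> K))"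

definition labelled_simplicial :: "'v set set \<Rightarrow> ('v \<Rightarrow> expo) \<Rightarrow> 'v labelled_complex" where
  "labelled_simplicial K lab = \<lparr> cells = K, rank = card, label = lab \<rparr>"

section \<open>The hull complex\<close>

text \<open>Points of \<open>\<real>\<^sup>n\<close> are functions \<open>nat \<Rightarrow> real\<close> vanishing at all indices \<open>\<ge> n\<close>; the pointwise
  vector space structure makes the library notions of convex hull and dimension available.\<close>

instantiation "fun" :: (type, real_vector) real_vector
begin

definition scaleR_fun_def: "r *\<^sub>R f = (\<lambda>x. r *\<^sub>R f x)"

instance
  by standard (simp_all add: scaleR_fun_def fun_eq_iff scaleR_add_right scaleR_add_left)

end

definition tpoint :: "nat \<Rightarrow> real \<Rightarrow> expo \<Rightarrow> nat \<Rightarrow> real" where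
  "tpoint n t a = (\<lambda>i. if i < n then t ^ Poly_Mapping.lookup a i else 0)"

definition hull_polyhedron :: "nat \<Rightarrow> 'k::comm_ring_1 mpoly set \<Rightarrow> real \<Rightarrow> (nat \<Rightarrow> real) set" where
  "hull_polyhedron n I t = convex hull {tpoint n t a | a. a \<in> exps n \<and> mon a \<in> I}"

text \<open>Faces of a polyhedron are its intersections with supporting hyperplanes; \<open>c = 0\<close> yields
  the empty face and the polyhedron itself.\<close>

definition polyhedron_face :: "nat \<Rightarrow> (nat \<Rightarrow> real) set \<Rightarrow> (nat \<Rightarrow> real) set \<Rightarrow> bool" where
  "polyhedron_face n P C \<longleftrightarrow> (\<exists>c \<beta>. (\<forall>x \<in> P. \<beta> \<le> (\<Sum>i<n. c i * x i)) \<and>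
     C = {x \<in> P. (\<Sum>i<n. c i * x i) = \<beta>})"

text \<open>The library's \<open>bounded\<close> on functions refers to a bounded metric for the product
  topology, so boundedness in \<open>\<real>\<^sup>n\<close> is spelled out.\<close>

definition bounded_points :: "nat \<Rightarrow> (nat \<Rightarrow> real) set \<Rightarrow> bool" where
  "bounded_points n C \<longleftrightarrow> (\<exists>B. \<forall>x \<in> C. \<forall>i<n. \<bar>x i\<bar> \<le> B)"

definition point_rank :: "(nat \<Rightarrow> real) set \<Rightarrow> nat" where
  "point_rank C = (if C = {} then 0 else Suc (dim {x - y | x y. x \<in> C \<and> y \<in> C}))"

definition hull_complex :: "nat \<Rightarrow> 'k::comm_ring_1 mpoly set \<Rightarrow> real \<Rightarrow> (nat \<Rightarrow> real) labelled_complex" where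
  "hull_complex n I t =
     \<lparr> cells = {C. polyhedron_face n (hull_polyhedron n I t) C \<and> bounded_points n C},
       rank = point_rank,
       label = (\<lambda>v. THE a. a \<in> exps n \<and> tpoint n t a = v) \<rparr>"

section \<open>The Lyubeznik complex\<close>

text \<open>The relation \<open>r\<close> is the reflexive version of the total order on the minimal generators.\<close>

definition lyubeznik_faces :: "nat \<Rightarrow> 'k::comm_ring_1 mpoly set \<Rightarrow> (expo \<times> expo) set \<Rightarrow> expo set set" where
  "lyubeznik_faces n I r = {W. finite W \<and> W \<subseteq> mingens n I \<and>
     \<not> (\<exists>m \<in> W. \<exists>q \<in> mingens n I. (q, m) \<in> r \<and> q \<noteq> m \<and> mdvd q (mlcm {w \<in> W. (m, w) \<in> r}))}"

definition lyubeznik_complex :: "nat \<Rightarrow> 'k::comm_ring_1 mpoly set \<Rightarrow> (expo \<times> expo) set \<Rightarrow> expo labelled_complex" where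
  "lyubeznik_complex n I r = labelled_simplicial (lyubeznik_faces n I r) (\<lambda>m. m)"

end

theory Submission
  imports Defs
begin

text \<open>One monomial ideal witnesses all three claims, namely
  \<open>I = (x\<^sub>0 x\<^sub>1, x\<^sub>2 x\<^sub>3, x\<^sub>0\<^sup>2, x\<^sub>3\<^sup>2, x\<^sub>1\<^sup>2 x\<^sub>2\<^sup>2)\<close> in four variables, its generators numbered \<open>0, \<dots>, 4\<close>.
  No variable occurs with the same positive exponent in two generators, so \<open>I\<close> is strongly generic,
  and for such ideals the hull resolution and the minimal resolution are both carried by the Scarf
  complex. Here that complex is a tetrahedron \<open>0123\<close> with a triangle \<open>014\<close> glued along the edge
  \<open>01\<close>. With the generators ordered as numbered, the Lyubeznik complex is the same complex.

  A DGA structure on the cellular complex of the Scarf complex is almost completely forced by the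
  multidegrees. The product \<open>e\<^sub>2 * e\<^sub>4\<close> can only involve the edges \<open>02\<close> and \<open>04\<close>, and by the Leibniz
  rule the coefficient of \<open>e\<^sub>0\<^sub>2\<close> is nonzero, since the path \<open>2 - 0 - 4\<close> is the only one between the
  two vertices in this multidegree. In the same way \<open>e\<^sub>0\<^sub>2 * e\<^sub>3\<close> is a nonzero multiple of \<open>e\<^sub>0\<^sub>2\<^sub>3\<close>.
  Hence \<open>e\<^sub>0\<^sub>2\<^sub>3\<close> occurs in \<open>(e\<^sub>2 * e\<^sub>4) * e\<^sub>3\<close>. But \<open>e\<^sub>4 * e\<^sub>3\<close> only involves the edges \<open>13\<close> and \<open>14\<close>, and for
  reasons of multidegree neither \<open>e\<^sub>2 * e\<^sub>1\<^sub>3\<close> nor \<open>e\<^sub>2 * e\<^sub>1\<^sub>4\<close> involves \<open>e\<^sub>0\<^sub>2\<^sub>3\<close>, so \<open>e\<^sub>0\<^sub>2\<^sub>3\<close> does not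
  occur in \<open>e\<^sub>2 * (e\<^sub>4 * e\<^sub>3)\<close>. Associativity fails. This is \<open>scarf_obstruction\<close>;
  \<open>scarf_copy_not_dga\<close> transfers it to every cell complex that is isomorphic to the Scarf complex
  with ranks and labels, whatever its incidence signs.

  It remains to identify the three resolutions. For the Lyubeznik complex this is a finite check on
  exponents (\<open>cell_iso_lyubeznik\<close>). For the hull complex, the bounded nonempty faces are the sets
  where a linear functional with positive coefficients attains its minimum; the sets of generators
  at which such minima are attained are exactly the nonempty Scarf faces (\<open>scarf_face_exposed\<close>,
  \<open>minimizers_in_scarf\<close>), which gives \<open>cell_iso_hull\<close>. That the Scarf complex supports a resolution
  follows because for every monomial \<open>m\<close> divisible by a generator the faces with label dividing
  \<open>m\<close> form a cone, and the cone construction is a contracting homotopy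
  (\<open>free_resolution_if_cones\<close>). It is minimal since removing a vertex from a face always changes
  the label (\<open>scarf_label_strict\<close>).\<close>

section \<open>Monomials\<close>

lemma mdvd_refl: "mdvd a a"
  by (simp add: mdvd_def)

lemma mdvd_trans: "mdvd a b \<Longrightarrow> mdvd b c \<Longrightarrow> mdvd a c"
  using order_trans by (fastforce simp: mdvd_def)

lemma mdvd_add_left: "mdvd a (a + b)"
  by (simp add: mdvd_def lookup_add)

lemma mdvd_antisym: "mdvd a b \<Longrightarrow> mdvd b a \<Longrightarrow> a = b"
  by (rule poly_mapping_eqI) (meson le_antisym mdvd_def)

lemma mdvd_add_diff:
  assumes "mdvd a b"
  shows "a + (b - a) = b" "(b - a) + a = b"
  using assms by (auto intro!: poly_mapping_eqI simp: mdvd_def lookup_add lookup_minus)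

lemma mdvd_iff_ex: "mdvd d k \<longleftrightarrow> (\<exists>q. k = d + q)"
  using mdvd_add_diff(1) mdvd_add_left by metis

lemma mdvd_diff_diff:
  assumes "mdvd a b" "mdvd b c"
  shows "(c - b) + (b - a) = c - a"
proof (rule poly_mapping_eqI)
  fix i
  have "Poly_Mapping.lookup a i \<le> Poly_Mapping.lookup b i"
    "Poly_Mapping.lookup b i \<le> Poly_Mapping.lookup c i"
    using assms by (auto simp: mdvd_def)
  then show "Poly_Mapping.lookup (c - b + (b - a)) i = Poly_Mapping.lookup (c - a) i"
    by (simp add: lookup_add lookup_minus)
qed

lemma mdvd_mlcm_iff:
  assumes "finite A"
  shows "mdvd (mlcm A) m \<longleftrightarrow> (\<forall>a\<in>A. mdvd a m)"
  using assms by (auto simp: mdvd_def lookup_mlcm)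

lemma mlcm_mono: "finite B \<Longrightarrow> A \<subseteq> B \<Longrightarrow> mdvd (mlcm A) (mlcm B)"
  by (meson finite_subset mdvd_mlcm_iff mdvd_refl subsetD)

lemma mlcm_empty [simp]: "mlcm {} = 0"
  by (rule poly_mapping_eqI) (simp add: lookup_mlcm)

lemma mlcm_singleton [simp]: "mlcm {a} = a"
  by (rule poly_mapping_eqI) (simp add: lookup_mlcm)

lemma exps_0: "0 \<in> exps n"
  by (simp add: exps_def)

lemma exps_iff: "a \<in> exps n \<longleftrightarrow> (\<forall>i\<ge>n. Poly_Mapping.lookup a i = 0)"
  unfolding exps_def by (force simp: in_keys_iff subset_iff not_less[symmetric])

lemma exps_add: "a \<in> exps n \<Longrightarrow> b \<in> exps n \<Longrightarrow> a + b \<in> exps n"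
  by (simp add: exps_iff lookup_add)

lemma exps_diff: "a \<in> exps n \<Longrightarrow> a - b \<in> exps n"
  by (simp add: exps_iff lookup_minus)

lemma exps_mlcm: "finite A \<Longrightarrow> A \<subseteq> exps n \<Longrightarrow> mlcm A \<in> exps n"
  by (auto simp: exps_iff lookup_mlcm subset_iff intro!: Max_eqI)

lemma lookup_times_single:
  fixes p :: "'k::comm_ring_1 mpoly"
  shows "Poly_Mapping.lookup (p * Poly_Mapping.single d c) k
    = (if mdvd d k then Poly_Mapping.lookup p (k - d) * c else 0)"
proof -
  have "Poly_Mapping.lookup (p * Poly_Mapping.single d c) k
      = Sum_any (\<lambda>l. (c when d = l) * Sum_any (\<lambda>q. Poly_Mapping.lookup p q when k = l + q))"
    by (simp add: mult.commute[of p] lookup_mult lookup_single)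
  also have "\<dots> = Sum_any (\<lambda>l. (c * Sum_any (\<lambda>q. Poly_Mapping.lookup p q when k = l + q) when d = l))"
    by (simp add: when_mult)
  also have "\<dots> = c * Sum_any (\<lambda>q. Poly_Mapping.lookup p q when k = d + q)"
    by simp
  also have "\<dots> = (if mdvd d k then Poly_Mapping.lookup p (k - d) * c else 0)"
  proof (cases "mdvd d k")
    case True
    have eq: "k = d + q \<longleftrightarrow> q = k - d" for q
      using mdvd_add_diff(1)[OF True] by auto
    show ?thesis using True by (simp add: eq mult.commute)
  next
    case False
    then have "k \<noteq> d + q" for q by (metis mdvd_iff_ex)
    with False show ?thesis by simp
  qed
  finally show ?thesis .
qed

lemma polys_0: "0 \<in> polys n"
  by (simp add: polys_def)

lemma polys_1: "1 \<in> polys n"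
  by (simp add: polys_def exps_0)

lemma polys_add: "p \<in> polys n \<Longrightarrow> q \<in> polys n \<Longrightarrow> p + q \<in> polys n"
  using keys_add[of p q] by (auto simp: polys_def)

lemma polys_sum: "(\<And>x. x \<in> A \<Longrightarrow> f x \<in> polys n) \<Longrightarrow> (\<Sum>x\<in>A. f x) \<in> polys n"
  by (induction A rule: infinite_finite_induct) (auto simp: polys_0 polys_add)

lemma polys_mult:
  fixes p q :: "'k::comm_ring_1 mpoly"
  assumes "p \<in> polys n" "q \<in> polys n"
  shows "p * q \<in> polys n"
proof -
  have "{a + b |a b. a \<in> Poly_Mapping.keys p \<and> b \<in> Poly_Mapping.keys q} \<subseteq> exps n"
    using assms by (auto simp: polys_def intro!: exps_add)
  with keys_mult[of p q] show ?thesis by (auto simp: polys_def)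
qed

lemma polys_single: "d \<in> exps n \<Longrightarrow> Poly_Mapping.single d c \<in> polys n"
  by (auto simp: polys_def)

lemma single_in_ideal:
  fixes A :: "expo set"
  assumes "finite A" "A \<subseteq> exps n" "a \<in> exps n"
  shows "(mon a :: 'k::comm_ring_1 mpoly) \<in> ideal_of n A \<longleftrightarrow> (\<exists>b\<in>A. mdvd b a)"
proof
  assume "(mon a :: 'k mpoly) \<in> ideal_of n A"
  then obtain B and q :: "expo \<Rightarrow> 'k mpoly"
    where B: "finite B" "B \<subseteq> A" and eq: "mon a = (\<Sum>b\<in>B. q b * mon b)"
    by (auto simp: ideal_of_def)
  have "(1::'k) = Poly_Mapping.lookup (mon a) a"
    by (simp add: mon_def)
  also have "\<dots> = (\<Sum>b\<in>B. Poly_Mapping.lookup (q b * mon b) a)"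
    by (simp add: eq lookup_sum)
  also have "\<dots> = (\<Sum>b\<in>B. if mdvd b a then Poly_Mapping.lookup (q b) (a - b) else 0)"
    by (simp add: mon_def lookup_times_single if_distrib cong: if_cong)
  finally have one: "1 = (\<Sum>b\<in>B. if mdvd b a then Poly_Mapping.lookup (q b) (a - b) else 0)" .
  have "\<exists>b\<in>B. mdvd b a"
  proof (rule ccontr)
    assume "\<not> (\<exists>b\<in>B. mdvd b a)"
    with one show False by simp
  qed
  with B show "\<exists>b\<in>A. mdvd b a" by blast
next
  assume "\<exists>b\<in>A. mdvd b a"
  then obtain b where b: "b \<in> A" "mdvd b a" by blast
  have "(mon a :: 'k mpoly) = mon (a - b) * mon b"
    using mdvd_add_diff(2)[OF b(2)] by (simp add: mon_def mult_single)
  moreover have "(mon (a - b) :: 'k mpoly) \<in> polys n"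
    using assms(3) by (simp add: mon_def polys_single exps_diff)
  ultimately show "(mon a :: 'k mpoly) \<in> ideal_of n A"
    unfolding ideal_of_def using b(1)
    by (intro CollectI exI[of _ "{b}"] exI[of _ "\<lambda>_. mon (a - b)"]) auto
qed

section \<open>Isomorphisms of labelled cell complexes and incidence functions\<close>

text \<open>Isomorphism of labelled complexes on the level of face posets. The last clause makes
  the condition \<open>\<epsilon> {v} {} = 1\<close> on incidence functions transferable: the isomorphism acts on cells,
  which are sets of points, and need not come from a map of points.\<close>
definition cell_iso :: "('u set \<Rightarrow> 'v set) \<Rightarrow> 'u labelled_complex \<Rightarrow> 'v labelled_complex \<Rightarrow> bool" where
  "cell_iso \<Phi> X Y \<longleftrightarrow>
     bij_betw \<Phi> (cells X) (cells Y) \<and> {} \<in> cells X \<and> \<Phi> {} = {} \<and>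
     (\<forall>C\<in>cells X. rank Y (\<Phi> C) = rank X C \<and> cell_label Y (\<Phi> C) = cell_label X C) \<and>
     (\<forall>C\<in>cells X. \<forall>D\<in>cells X. \<Phi> D \<subseteq> \<Phi> C \<longleftrightarrow> D \<subseteq> C) \<and>
     (\<forall>v\<in>vertices Y. \<exists>u\<in>vertices X. \<Phi> {u} = {v})"

lemma cell_iso_facet_in:
  assumes "cell_iso \<Phi> X Y" "C \<in> cells X" "D \<in> cells X"
  shows "facet_in Y (\<Phi> D) (\<Phi> C) \<longleftrightarrow> facet_in X D C"
  using assms bij_betwE unfolding cell_iso_def facet_in_def by metis

lemma cell_iso_incidence_function:
  assumes iso: "cell_iso \<Phi> X Y" and inc: "incidence_function X \<epsilon>"
  shows "\<exists>\<epsilon>'. incidence_function Y \<epsilon>'"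
proof -
  define \<Psi> where "\<Psi> = inv_into (cells X) \<Phi>"
  have bij: "bij_betw \<Phi> (cells X) (cells Y)" and emp: "{} \<in> cells X" "\<Phi> {} = {}"
    using iso by (auto simp: cell_iso_def)
  have \<Psi>\<Phi>: "\<Psi> (\<Phi> C) = C" if "C \<in> cells X" for C
    using that bij by (simp add: \<Psi>_def bij_betw_inv_into_left)
  have surj: "\<exists>C'\<in>cells X. C = \<Phi> C'" if "C \<in> cells Y" for C
    using that bij by (auto simp: bij_betw_def)
  have signs: "\<epsilon> (\<Psi> C) (\<Psi> D) \<in> {1, -1}" if "facet_in Y D C" for C D
  proof -
    obtain C' D' where "C' \<in> cells X" "D' \<in> cells X" "C = \<Phi> C'" "D = \<Phi> D'"
      using \<open>facet_in Y D C\<close> surj unfolding facet_in_def by metis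
    with that inc cell_iso_facet_in[OF iso] show ?thesis
      by (simp add: \<Psi>\<Phi> incidence_function_def)
  qed
  have vert: "\<epsilon> (\<Psi> {v}) (\<Psi> {}) = 1" if "v \<in> vertices Y" for v
  proof -
    have "\<forall>v\<in>vertices Y. \<exists>u\<in>vertices X. \<Phi> {u} = {v}"
      using iso by (simp add: cell_iso_def)
    with that obtain u where u: "u \<in> vertices X" "\<Phi> {u} = {v}"
      by blast
    then have "\<Psi> {v} = {u}" "\<Psi> {} = {}"
      using \<Psi>\<Phi>[of "{u}"] \<Psi>\<Phi>[OF emp(1)] emp(2) by (auto simp: vertices_def)
    with u(1) inc show ?thesis by (simp add: incidence_function_def)
  qed
  have square: "(\<Sum>D | facet_in Y D C \<and> facet_in Y E D. \<epsilon> (\<Psi> C) (\<Psi> D) * \<epsilon> (\<Psi> D) (\<Psi> E)) = 0"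
    if CE: "C \<in> cells Y" "E \<in> cells Y" "E \<subseteq> C" "rank Y C = rank Y E + 2" for C E
  proof -
    obtain C' E' where C': "C' \<in> cells X" "C = \<Phi> C'" and E': "E' \<in> cells X" "E = \<Phi> E'"
      using CE surj by metis
    have sub: "E' \<subseteq> C'" "rank X C' = rank X E' + 2"
      using iso CE C' E' by (auto simp: cell_iso_def)
    let ?S = "{D. facet_in X D C' \<and> facet_in X E' D}"
    have S: "?S \<subseteq> cells X" by (auto simp: facet_in_def)
    have "{D. facet_in Y D C \<and> facet_in Y E D} = \<Phi> ` ?S"
    proof
      show "\<Phi> ` ?S \<subseteq> {D. facet_in Y D C \<and> facet_in Y E D}"
        using S C' E' cell_iso_facet_in[OF iso] by auto
      show "{D. facet_in Y D C \<and> facet_in Y E D} \<subseteq> \<Phi> ` ?S"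
      proof
        fix D assume D: "D \<in> {D. facet_in Y D C \<and> facet_in Y E D}"
        then have "D \<in> cells Y" by (auto simp: facet_in_def)
        then obtain D' where "D' \<in> cells X" "D = \<Phi> D'"
          using surj by blast
        with D C' E' cell_iso_facet_in[OF iso] show "D \<in> \<Phi> ` ?S" by auto
      qed
    qed
    moreover have "inj_on \<Phi> ?S"
      using bij S by (meson bij_betw_def inj_on_subset)
    ultimately have "(\<Sum>D | facet_in Y D C \<and> facet_in Y E D. \<epsilon> (\<Psi> C) (\<Psi> D) * \<epsilon> (\<Psi> D) (\<Psi> E))
        = (\<Sum>D\<in>?S. \<epsilon> (\<Psi> C) (\<Psi> (\<Phi> D)) * \<epsilon> (\<Psi> (\<Phi> D)) (\<Psi> E))"
      by (simp add: sum.reindex)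
    also have "\<dots> = (\<Sum>D\<in>?S. \<epsilon> C' D * \<epsilon> D E')"
      using S C' E' by (intro sum.cong) (auto simp: \<Psi>\<Phi>)
    also have "\<dots> = 0"
      using inc C'(1) E'(1) sub by (simp add: incidence_function_def)
    finally show ?thesis .
  qed
  have "incidence_function Y (\<lambda>C D. \<epsilon> (\<Psi> C) (\<Psi> D))"
    unfolding incidence_function_def using signs vert square by blast
  then show ?thesis by blast
qed

lemma labelled_simplicial_simps [simp]:
  "cells (labelled_simplicial K lab) = K" "rank (labelled_simplicial K lab) = card"
  "label (labelled_simplicial K lab) = lab"
  by (simp_all add: labelled_simplicial_def)

lemma vertices_simplicial: "vertices (labelled_simplicial K lab) = {v. {v} \<in> K}"
  by (simp add: vertices_def)

lemma cell_label_simplicial: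
  assumes "abstract_simplicial_complex K" "W \<in> K"
  shows "cell_label (labelled_simplicial K lab) W = mlcm (lab ` W)"
proof -
  have "W \<inter> {v. {v} \<in> K} = W"
    using assms by (auto simp: abstract_simplicial_complex_def)
  then show ?thesis by (simp add: cell_label_def vertices_simplicial)
qed

lemma facet_in_simplicial:
  assumes "abstract_simplicial_complex K"
  shows "facet_in (labelled_simplicial K lab) V W \<longleftrightarrow> W \<in> K \<and> (\<exists>v. v \<notin> V \<and> W = insert v V)"
proof
  assume "facet_in (labelled_simplicial K lab) V W"
  then have "V \<in> K" "W \<in> K" "V \<subseteq> W" "card W = Suc (card V)"
    by (auto simp: facet_in_def)
  moreover have "finite W"
    using \<open>W \<in> K\<close> assms by (auto simp: abstract_simplicial_complex_def)
  ultimately have "card (W - V) = 1"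
    by (simp add: card_Diff_subset finite_subset)
  then obtain v where "W - V = {v}"
    by (auto simp: card_1_singleton_iff)
  with \<open>V \<subseteq> W\<close> \<open>W \<in> K\<close> show "W \<in> K \<and> (\<exists>v. v \<notin> V \<and> W = insert v V)" by blast
next
  assume *: "W \<in> K \<and> (\<exists>v. v \<notin> V \<and> W = insert v V)"
  then have "finite W" "\<forall>V\<subseteq>W. V \<in> K"
    using assms by (auto simp: abstract_simplicial_complex_def)
  moreover have "V \<subseteq> W"
    using * by blast
  ultimately have "finite W" "V \<in> K" by auto
  with * show "facet_in (labelled_simplicial K lab) V W"
    by (auto simp: facet_in_def)
qed

text \<open>For \<open>W = insert v V\<close> the inner existential names \<open>v\<close>, so this is the usual alternating sign
  of the face opposite to \<open>v\<close>.\<close>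
definition simplicial_sign :: "'v::linorder set \<Rightarrow> 'v set \<Rightarrow> int" where
  "simplicial_sign W V = (-1) ^ card {w\<in>V. \<exists>v\<in>W-V. w < v}"

lemma simplicial_sign_insert:
  "v \<notin> V \<Longrightarrow> simplicial_sign (insert v V) V = (-1) ^ card {w\<in>V. w < v}"
  by (simp add: simplicial_sign_def insert_Diff_if)

text \<open>Deleting \<open>b\<close> first leaves the sign of deleting \<open>a\<close> unchanged, whereas deleting \<open>a\<close> first
  removes one vertex below \<open>b\<close> and so flips the sign of deleting \<open>b\<close>.\<close>
lemma simplicial_sign_square:
  fixes a b :: "'v::linorder"
  assumes "finite E" "a \<notin> E" "b \<notin> E" "a < b"
  shows "simplicial_sign (insert a (insert b E)) (insert a E) * simplicial_sign (insert a E) E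
    + simplicial_sign (insert a (insert b E)) (insert b E) * simplicial_sign (insert b E) E = 0"
proof -
  have "{w \<in> insert a E. w < b} = insert a {w\<in>E. w < b}" "{w \<in> insert b E. w < a} = {w\<in>E. w < a}"
    using assms(4) by auto
  then have c: "card {w \<in> insert a E. w < b} = Suc (card {w\<in>E. w < b})"
    "card {w \<in> insert b E. w < a} = card {w\<in>E. w < a}"
    using assms by auto
  have "simplicial_sign (insert b (insert a E)) (insert a E) = - ((-1) ^ card {w\<in>E. w < b})"
    using assms c by (subst simplicial_sign_insert) auto
  moreover have "simplicial_sign (insert a (insert b E)) (insert b E) = (-1) ^ card {w\<in>E. w < a}"
    using assms c by (subst simplicial_sign_insert) auto
  ultimately show ?thesis
    using assms by (simp add: simplicial_sign_insert insert_commute)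
qed

lemma incidence_function_simplicial:
  fixes K :: "'v::linorder set set"
  assumes K: "abstract_simplicial_complex K"
  shows "incidence_function (labelled_simplicial K lab) simplicial_sign"
proof -
  have "(\<Sum>D | facet_in (labelled_simplicial K lab) D C \<and> facet_in (labelled_simplicial K lab) E D.
      simplicial_sign C D * simplicial_sign D E) = 0"
    if "C \<in> K" "E \<in> K" "E \<subseteq> C" "card C = card E + 2" for C E
  proof -
    have fin: "finite C" "finite E"
      using that K by (auto simp: abstract_simplicial_complex_def)
    then have "card (C - E) = 2"
      using that by (simp add: card_Diff_subset)
    then obtain a b where ab: "C - E = {a, b}" "a < b"
      by (metis card_2_iff insert_commute neq_iff)
    have C: "C = insert a (insert b E)" "a \<notin> E" "b \<notin> E"
      using ab(1) that(3) by auto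
    have "V \<in> K" if "V \<subseteq> C" for V
      using K \<open>C \<in> K\<close> that by (auto simp: abstract_simplicial_complex_def)
    then have down: "insert a E \<in> K" "insert b E \<in> K"
      using C(1) by auto
    have "{D. facet_in (labelled_simplicial K lab) D C \<and> facet_in (labelled_simplicial K lab) E D}
        = {insert a E, insert b E}"
      unfolding facet_in_simplicial[OF K] using C ab(2) down that(1) by auto
    moreover have "insert a E \<noteq> insert b E"
      using C ab(2) by auto
    ultimately show ?thesis
      using simplicial_sign_square[OF fin(2) C(2,3) ab(2)] by (simp add: C(1))
  qed
  moreover have "simplicial_sign W V \<in> {1, -1}" for V W :: "'v set"
    by (cases "even (card {w\<in>V. \<exists>v\<in>W-V. w < v})") (auto simp: simplicial_sign_def)
  moreover have "simplicial_sign {v} {} = 1" for v :: 'v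
    by (simp add: simplicial_sign_def)
  ultimately show ?thesis
    unfolding incidence_function_def by auto
qed

section \<open>Structure constants of a multiplication\<close>

definition basis_el :: "'b \<Rightarrow> 'b \<Rightarrow> 'k::comm_ring_1 mpoly" where
  "basis_el b = (\<lambda>c. if c = b then 1 else 0)"

lemma basis_el_in_module: "b \<in> basis F \<Longrightarrow> basis_el b \<in> total_module n F"
  by (auto simp: basis_el_def total_module_def polys_0 polys_1)

lemma basis_el_in_hpart: "b \<in> basis F \<Longrightarrow> basis_el b \<in> hpart n F (hdeg F b)"
  by (simp add: hpart_def basis_el_in_module) (simp add: basis_el_def)

lemma homogeneous_basis_el:
  "homogeneous F (mdeg F b) (basis_el b :: 'b \<Rightarrow> 'k::comm_ring_1 mpoly)"
  by (auto simp: homogeneous_def basis_el_def fun_eq_iff split: if_splits)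

lemma one_el_eq_basis_el: "one_el F = basis_el (unit_el F)"
  by (simp add: one_el_def basis_el_def)

lemma zero_in_module: "0 \<in> total_module n F"
  by (simp add: total_module_def polys_0)

lemma sum_apply: "(\<Sum>x\<in>A. f x) c = (\<Sum>x\<in>A. f x c)"
  by (induction A rule: infinite_finite_induct) auto

lemma module_expand:
  assumes "finite (basis F)" "f \<in> total_module n F"
  shows "f = (\<Sum>b\<in>basis F. smul (f b) (basis_el b))"
proof
  fix c
  have "(\<Sum>b\<in>basis F. smul (f b) (basis_el b)) c = (\<Sum>b\<in>basis F. if b = c then f b else 0)"
    unfolding sum_apply by (intro sum.cong) (auto simp: smul_def basis_el_def)
  also have "\<dots> = f c"
    using assms by (auto simp: total_module_def)
  finally show "f c = (\<Sum>b\<in>basis F. smul (f b) (basis_el b)) c" ..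
qed

lemma module_sum_closed:
  "(\<And>b. b \<in> B \<Longrightarrow> f b \<in> total_module n F) \<Longrightarrow> (\<Sum>b\<in>B. f b) \<in> total_module n F"
  by (auto simp: total_module_def sum_apply intro!: polys_sum)

lemma module_smul_closed:
  "s \<in> polys n \<Longrightarrow> f \<in> total_module n F \<Longrightarrow> smul s f \<in> total_module n F"
  by (auto simp: total_module_def smul_def intro!: polys_mult)

lemma additive_on_sum:
  fixes \<phi> :: "('b \<Rightarrow> 'k::comm_ring_1 mpoly) \<Rightarrow> ('c \<Rightarrow> 'k mpoly)"
  assumes add: "\<And>f g. f \<in> total_module n F \<Longrightarrow> g \<in> total_module n F \<Longrightarrow> \<phi> (f + g) = \<phi> f + \<phi> g"
    and mem: "\<And>b. b \<in> B \<Longrightarrow> f b \<in> total_module n F"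
  shows "\<phi> (\<Sum>b\<in>B. f b) = (\<Sum>b\<in>B. \<phi> (f b))"
proof -
  have "\<phi> (0 + 0) = \<phi> 0 + \<phi> 0"
    using add zero_in_module by blast
  then have zero: "\<phi> 0 = 0" by simp
  show ?thesis
    using mem
    by (induction B rule: infinite_finite_induct) (auto simp: zero add module_sum_closed)
qed

lemma dga_linear:
  assumes "dga_structure n F mul" "f \<in> total_module n F" "g \<in> total_module n F"
  shows "h \<in> total_module n F \<Longrightarrow> mul (f + g) h = mul f h + mul g h"
    and "h \<in> total_module n F \<Longrightarrow> mul h (f + g) = mul h f + mul h g"
    and "s \<in> polys n \<Longrightarrow> mul (smul s f) g = smul s (mul f g)"
    and "s \<in> polys n \<Longrightarrow> mul f (smul s g) = smul s (mul f g)"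
proof -
  let ?M = "total_module n F"
  have "\<forall>f\<in>?M. \<forall>g\<in>?M. \<forall>h\<in>?M. mul (f + g) h = mul f h + mul g h \<and> mul h (f + g) = mul h f + mul h g"
    using assms(1) unfolding dga_structure_def Let_def by (elim conjE)
  moreover have "\<forall>s\<in>polys n. \<forall>f\<in>?M. \<forall>g\<in>?M. mul (smul s f) g = smul s (mul f g) \<and> mul f (smul s g) = smul s (mul f g)"
    using assms(1) unfolding dga_structure_def Let_def by (elim conjE)
  ultimately show "h \<in> ?M \<Longrightarrow> mul (f + g) h = mul f h + mul g h"
    and "h \<in> ?M \<Longrightarrow> mul h (f + g) = mul h f + mul h g"
    and "s \<in> polys n \<Longrightarrow> mul (smul s f) g = smul s (mul f g)"
    and "s \<in> polys n \<Longrightarrow> mul f (smul s g) = smul s (mul f g)"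
    using assms(2,3) by blast+
qed

text \<open>Bilinearity reduces a multiplication to its structure constants, the coefficients of
  the products of basis elements. The lemmas up to the end of this section rephrase the axioms as
  polynomial identities between structure constants and entries of the differential.\<close>
lemma dga_expand:
  assumes dga: "dga_structure n F mul" and fin: "finite (basis F)"
    and f: "f \<in> total_module n F" and g: "g \<in> total_module n F"
  shows "mul f g c = (\<Sum>b\<in>basis F. f b * mul (basis_el b) g c)"
    and "mul g f c = (\<Sum>b\<in>basis F. f b * mul g (basis_el b) c)"
proof -
  let ?t = "\<lambda>b. smul (f b) (basis_el b)"
  have fp: "f b \<in> polys n" if "b \<in> basis F" for b
    using f that by (simp add: total_module_def)
  have t: "?t b \<in> total_module n F" if "b \<in> basis F" for b
    by (intro module_smul_closed fp basis_el_in_module that)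
  have "mul f g = mul (\<Sum>b\<in>basis F. ?t b) g"
    by (rule arg_cong[where f = "\<lambda>f. mul f g", OF module_expand[OF fin f]])
  also have "\<dots> = (\<Sum>b\<in>basis F. mul (?t b) g)"
    by (rule additive_on_sum[where \<phi> = "\<lambda>f. mul f g", OF dga_linear(1)[OF dga _ _ g] t])
  also have "\<dots> = (\<Sum>b\<in>basis F. smul (f b) (mul (basis_el b) g))"
    by (intro sum.cong refl dga_linear(3)[OF dga] basis_el_in_module g fp)
  finally show "mul f g c = (\<Sum>b\<in>basis F. f b * mul (basis_el b) g c)"
    by (simp add: sum_apply smul_def)
  have "mul g f = mul g (\<Sum>b\<in>basis F. ?t b)"
    by (rule arg_cong[where f = "\<lambda>f. mul g f", OF module_expand[OF fin f]])
  also have "\<dots> = (\<Sum>b\<in>basis F. mul g (?t b))"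
    by (rule additive_on_sum[where \<phi> = "\<lambda>f. mul g f", OF dga_linear(2)[OF dga _ _ g] t])
  also have "\<dots> = (\<Sum>b\<in>basis F. smul (f b) (mul g (basis_el b)))"
    by (intro sum.cong refl dga_linear(4)[OF dga] basis_el_in_module g fp)
  finally show "mul g f c = (\<Sum>b\<in>basis F. f b * mul g (basis_el b) c)"
    by (simp add: sum_apply smul_def)
qed

lemma dga_product_in_module:
  "dga_structure n F mul \<Longrightarrow> a \<in> basis F \<Longrightarrow> b \<in> basis F
    \<Longrightarrow> mul (basis_el a) (basis_el b) \<in> total_module n F"
  by (simp add: dga_structure_def Let_def basis_el_in_module)

text \<open>The gradings restrict the structure constants: a basis element can occur
  in a product of basis elements only if its homological degree is the sum of theirs and its
  multidegree divides the product of theirs.\<close>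
lemma dga_product_support:
  assumes dga: "dga_structure n F mul" and a: "a \<in> basis F" and b: "b \<in> basis F"
    and nz: "mul (basis_el a) (basis_el b) c \<noteq> 0"
  shows "c \<in> basis F" "hdeg F c = hdeg F a + hdeg F b" "mdeg F c i \<le> mdeg F a i + mdeg F b i"
proof -
  let ?ab = "mul (basis_el a) (basis_el b)"
  have "?ab \<in> hpart n F (hdeg F a + hdeg F b)"
    using dga basis_el_in_hpart[OF a] basis_el_in_hpart[OF b] by (simp add: dga_structure_def Let_def)
  with nz show "c \<in> basis F" "hdeg F c = hdeg F a + hdeg F b"
    by (auto simp: hpart_def total_module_def)
  have hom: "homogeneous F (mdeg F a + mdeg F b) ?ab"
    using dga basis_el_in_module[OF a] basis_el_in_module[OF b]
    by (simp add: dga_structure_def Let_def homogeneous_basis_el)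
  obtain m where "m \<in> Poly_Mapping.keys (?ab c)"
    using nz by (metis keys_eq_empty ex_in_conv)
  with hom have "mdeg F a + mdeg F b = (\<lambda>i. int (Poly_Mapping.lookup m i)) + mdeg F c"
    unfolding homogeneous_def by blast
  from fun_cong[OF this, of i] show "mdeg F c i \<le> mdeg F a i + mdeg F b i" by simp
qed

lemma dga_associativity:
  assumes dga: "dga_structure n F mul" and fin: "finite (basis F)"
    and abc: "a \<in> basis F" "b \<in> basis F" "c \<in> basis F"
  shows "(\<Sum>x\<in>basis F. mul (basis_el a) (basis_el b) x * mul (basis_el x) (basis_el c) d)
    = (\<Sum>x\<in>basis F. mul (basis_el b) (basis_el c) x * mul (basis_el a) (basis_el x) d)"
proof -
  have "mul (mul (basis_el a) (basis_el b)) (basis_el c) = mul (basis_el a) (mul (basis_el b) (basis_el c))"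
    using dga abc by (simp add: dga_structure_def Let_def basis_el_in_module)
  then show ?thesis
    using dga_expand(1)[OF dga fin dga_product_in_module[OF dga abc(1,2)] basis_el_in_module[OF abc(3)]]
      dga_expand(2)[OF dga fin dga_product_in_module[OF dga abc(2,3)] basis_el_in_module[OF abc(1)]]
    by simp
qed

lemma bd_basis_el:
  assumes "finite (basis F)" "b \<in> basis F" "c \<in> basis F"
  shows "bd F (basis_el b) c = dmat F b c"
proof -
  have "bd F (basis_el b) c = (\<Sum>x\<in>basis F. if x = b then dmat F x c else 0)"
    using assms(3) unfolding bd_def by (auto simp: basis_el_def intro!: sum.cong)
  with assms show ?thesis by simp
qed

lemma dga_leibniz:
  assumes dga: "dga_structure n F mul" and fin: "finite (basis F)"
    and polys: "\<And>b c. b \<in> basis F \<Longrightarrow> c \<in> basis F \<Longrightarrow> dmat F b c \<in> polys n"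
    and ab: "a \<in> basis F" "b \<in> basis F" and c: "c \<in> basis F"
  shows "(\<Sum>x\<in>basis F. mul (basis_el a) (basis_el b) x * dmat F x c)
    = (\<Sum>x\<in>basis F. dmat F a x * mul (basis_el x) (basis_el b) c)
      + (-1) ^ hdeg F a * (\<Sum>x\<in>basis F. dmat F b x * mul (basis_el a) (basis_el x) c)"
proof -
  have bdm: "bd F (basis_el x) \<in> total_module n F" if "x \<in> basis F" for x
    using polys that fin by (auto simp: total_module_def bd_basis_el) (simp add: bd_def)
  have "\<forall>i. \<forall>f \<in> hpart n F i. \<forall>g\<in>total_module n F.
      bd F (mul f g) = mul (bd F f) g + smul ((-1) ^ i) (mul f (bd F g))"
    using dga unfolding dga_structure_def Let_def by (elim conjE)
  then have "bd F (mul (basis_el a) (basis_el b)) = mul (bd F (basis_el a)) (basis_el b)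
      + smul ((-1) ^ hdeg F a) (mul (basis_el a) (bd F (basis_el b)))"
    using basis_el_in_hpart[OF ab(1)] basis_el_in_module[OF ab(2)] by blast
  from fun_cong[OF this, of c]
  have "bd F (mul (basis_el a) (basis_el b)) c = mul (bd F (basis_el a)) (basis_el b) c
      + (-1) ^ hdeg F a * mul (basis_el a) (bd F (basis_el b)) c"
    by (simp add: smul_def)
  moreover have "mul (bd F (basis_el a)) (basis_el b) c
      = (\<Sum>x\<in>basis F. dmat F a x * mul (basis_el x) (basis_el b) c)"
    using dga_expand(1)[OF dga fin bdm[OF ab(1)] basis_el_in_module[OF ab(2)]] fin ab
    by (simp add: bd_basis_el)
  moreover have "mul (basis_el a) (bd F (basis_el b)) c
      = (\<Sum>x\<in>basis F. dmat F b x * mul (basis_el a) (basis_el x) c)"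
    using dga_expand(2)[OF dga fin bdm[OF ab(2)] basis_el_in_module[OF ab(1)]] fin ab
    by (simp add: bd_basis_el)
  ultimately show ?thesis
    using c by (simp add: bd_def)
qed

lemma dga_unit:
  assumes "dga_structure n F mul" "b \<in> basis F"
  shows "mul (basis_el (unit_el F)) (basis_el b) = basis_el b"
    and "mul (basis_el b) (basis_el (unit_el F)) = basis_el b"
  using assms basis_el_in_module[OF assms(2), of n]
  by (simp_all add: dga_structure_def Let_def one_el_eq_basis_el)

section \<open>The ideal and its Scarf complex\<close>

text \<open>The numbering of the generators is at the same time the order used for the Lyubeznik
  resolution.\<close>
definition gen :: "nat \<Rightarrow> expo" where
  "gen v = (if v = 0 then Poly_Mapping.single 0 1 + Poly_Mapping.single 1 1
     else if v = 1 then Poly_Mapping.single 2 1 + Poly_Mapping.single 3 1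
     else if v = 2 then Poly_Mapping.single 0 2
     else if v = 3 then Poly_Mapping.single 3 2
     else Poly_Mapping.single 1 2 + Poly_Mapping.single 2 2)"

text \<open>The missing edges \<open>24\<close> and \<open>34\<close> are those whose labels are divisible by a third generator:
  the lcm of generators \<open>2\<close> and \<open>4\<close> by generator \<open>0\<close>, that of \<open>3\<close> and \<open>4\<close> by generator \<open>1\<close>.\<close>
definition scarf :: "nat set set" where
  "scarf = {W. W \<subseteq> {..<5} \<and> (4 \<in> W \<longrightarrow> 2 \<notin> W \<and> 3 \<notin> W)}"

lemma lookup_gen:
  "Poly_Mapping.lookup (gen v) i =
    (if v = 0 then (if i = 0 \<or> i = 1 then 1 else 0)
     else if v = 1 then (if i = 2 \<or> i = 3 then 1 else 0)
     else if v = 2 then (if i = 0 then 2 else 0)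
     else if v = 3 then (if i = 3 then 2 else 0)
     else (if i = 1 \<or> i = 2 then 2 else 0))"
  by (simp add: gen_def lookup_add lookup_single when_def del: single_numeral)

lemma less_5_cases: "(v::nat) < 5 \<longleftrightarrow> v = 0 \<or> v = 1 \<or> v = 2 \<or> v = 3 \<or> v = 4"
  by auto

lemma less_4_cases: "(\<forall>i<4. P i) \<longleftrightarrow> P 0 \<and> P 1 \<and> P 2 \<and> P (3::nat)"
proof -
  have "i < 4 \<longleftrightarrow> i = 0 \<or> i = 1 \<or> i = 2 \<or> i = 3" for i :: nat by auto
  then show ?thesis by auto
qed

lemma gen_in_exps: "gen v \<in> exps 4"
  by (auto simp: exps_iff lookup_gen)

lemma mdvd_gen:
  "mdvd (gen v) m \<longleftrightarrow> (\<forall>i<4. Poly_Mapping.lookup (gen v) i \<le> Poly_Mapping.lookup m i)"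
  using gen_in_exps[of v] unfolding mdvd_def exps_iff by (metis le0 not_le)

lemma inj_gen: "inj_on gen {..<5}"
proof (rule inj_onI)
  fix v w assume *: "v \<in> {..<5}" "w \<in> {..<5}" "gen v = gen w"
  have "\<forall>i<4. Poly_Mapping.lookup (gen v) i = Poly_Mapping.lookup (gen w) i"
    using *(3) by simp
  with *(1,2) show "v = w"
    by (auto simp: less_4_cases lookup_gen less_5_cases)
qed

lemma finite_scarf: "finite scarf"
  by (rule finite_subset[of _ "Pow {..<5}"]) (auto simp: scarf_def)

lemma scarf_simplicial: "abstract_simplicial_complex scarf"
proof -
  have "finite W" if "W \<in> scarf" for W
    using that finite_subset[of W "{..<5}"] by (auto simp: scarf_def)
  then show ?thesis
    using finite_scarf by (auto simp: abstract_simplicial_complex_def scarf_def)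
qed

lemma finite_in_scarf: "W \<in> scarf \<Longrightarrow> finite W"
  using scarf_simplicial by (simp add: abstract_simplicial_complex_def)

section \<open>The associativity obstruction\<close>

text \<open>The argument depends on nothing but the structure constants \<open>\<mu>\<close> and the entries \<open>\<delta>\<close> of the
  differential, and about the latter only on where they may be nonzero and on the augmentation.
  Abstracting from the module in this way lets the vertices of a copy be points of space or
  monomials.\<close>
lemma scarf_obstruction:
  fixes \<mu> :: "nat set \<Rightarrow> nat set \<Rightarrow> nat set \<Rightarrow> 'r::idom"
    and \<delta> :: "nat set \<Rightarrow> nat set \<Rightarrow> 'r"
  assumes deg: "\<And>A B C. A \<in> scarf \<Longrightarrow> B \<in> scarf \<Longrightarrow> C \<in> scarf \<Longrightarrow> \<mu> A B C \<noteq> 0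
      \<Longrightarrow> card C = card A + card B"
    and mdeg: "\<And>A B C v. A \<in> scarf \<Longrightarrow> B \<in> scarf \<Longrightarrow> C \<in> scarf \<Longrightarrow> \<mu> A B C \<noteq> 0
      \<Longrightarrow> v \<in> C \<Longrightarrow> mdvd (gen v) (mlcm (gen ` A) + mlcm (gen ` B))"
    and leibniz: "\<And>A B C. A \<in> scarf \<Longrightarrow> B \<in> scarf \<Longrightarrow> C \<in> scarf \<Longrightarrow>
      (\<Sum>X\<in>scarf. \<mu> A B X * \<delta> X C)
        = (\<Sum>X\<in>scarf. \<delta> A X * \<mu> X B C) + (-1) ^ card A * (\<Sum>X\<in>scarf. \<delta> B X * \<mu> A X C)"
    and unit: "\<And>B C. B \<in> scarf \<Longrightarrow> C \<in> scarf \<Longrightarrow> \<mu> {} B C = (if C = B then 1 else 0)"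
      "\<And>B C. B \<in> scarf \<Longrightarrow> C \<in> scarf \<Longrightarrow> \<mu> B {} C = (if C = B then 1 else 0)"
    and assoc: "\<And>A B C D. A \<in> scarf \<Longrightarrow> B \<in> scarf \<Longrightarrow> C \<in> scarf \<Longrightarrow> D \<in> scarf \<Longrightarrow>
      (\<Sum>X\<in>scarf. \<mu> A B X * \<mu> X C D) = (\<Sum>X\<in>scarf. \<mu> B C X * \<mu> A X D)"
    and diff: "\<And>A B. A \<in> scarf \<Longrightarrow> B \<in> scarf \<Longrightarrow> \<delta> A B \<noteq> 0 \<Longrightarrow> B \<subseteq> A \<and> card A = Suc (card B)"
    and aug: "\<And>v. v < 5 \<Longrightarrow> \<delta> {v} {} \<noteq> 0"
  shows False
proof -
  have v1: "{v} \<in> scarf" if "v < 5" for v using that by (auto simp: scarf_def)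
  have faces: "{} \<in> scarf" "{0,2} \<in> scarf" "{0,2,3} \<in> scarf" "{0,4} \<in> scarf" "{0,3} \<in> scarf" "{1,3} \<in> scarf" "{1,4} \<in> scarf"
    by (auto simp: scarf_def)
  note fin = finite_scarf
  have pick: "sum f scarf = f X" if "X \<in> scarf" "\<And>Y. Y \<in> scarf \<Longrightarrow> Y \<noteq> X \<Longrightarrow> f Y = 0" for f :: "nat set \<Rightarrow> 'r" and X
  proof -
    have "sum f (scarf - {X}) = 0"
      using that(2) by (intro sum.neutral) auto
    then show ?thesis
      using sum.remove[OF fin that(1), of f] by simp
  qed
  have card0: "X = {}" if "X \<in> scarf" "card X = 0" for X
    using that finite_in_scarf by auto
  have bnd: "v < 5" if "X \<in> scarf" "v \<in> X" for X v
    using that by (auto simp: scarf_def)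
  \<comment> \<open>The boundary of a vertex is a multiple of the unit.\<close>
  have aug_sum: "(\<Sum>X\<in>scarf. \<delta> {v} X * f X) = \<delta> {v} {} * f {}" if "v < 5" for v and f :: "nat set \<Rightarrow> 'r"
  proof (rule pick[OF faces(1)])
    fix Y assume "Y \<in> scarf" "Y \<noteq> {}"
    then show "\<delta> {v} Y * f Y = 0"
      using diff[OF v1[OF that], of Y] card0[of Y] by force
  qed

  \<comment> \<open>The vertices that can occur in the products considered below, read off from multidegrees.\<close>
  have d24: "v \<in> {0,2,4}" if "v < 5" "mdvd (gen v) (mlcm (gen ` {2}) + mlcm (gen ` {4}))" for v
    using that by (auto simp: mdvd_gen lookup_add less_4_cases lookup_gen less_5_cases)
  have d43: "v \<in> {1,3,4}" if "v < 5" "mdvd (gen v) (mlcm (gen ` {4}) + mlcm (gen ` {3}))" for v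
    using that by (auto simp: mdvd_gen lookup_add less_4_cases lookup_gen less_5_cases)
  have d023: "v \<in> {0,2,3}" if "v < 5" "mdvd (gen v) (mlcm (gen ` {0,2}) + mlcm (gen ` {3}))" for v
    using that by (auto simp: mdvd_gen lookup_add lookup_mlcm less_4_cases lookup_gen less_5_cases)

  \<comment> \<open>Compare coefficients at \<open>2\<close> in the boundary of \<open>e\<^sub>2 * e\<^sub>4\<close>: the Leibniz rule gives a nonzero
    multiple of \<open>e\<^sub>2\<close>, and \<open>02\<close> is the only available edge through \<open>2\<close>.\<close>
  have p: "\<mu> {2} {4} {0,2} \<noteq> 0"
  proof -
    have "(\<Sum>X\<in>scarf. \<mu> {2} {4} X * \<delta> X {2}) = - \<delta> {4} {}"
      using leibniz[of "{2}" "{4}" "{2}"] by (simp add: v1 faces aug_sum unit)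
    then have "(\<Sum>X\<in>scarf. \<mu> {2} {4} X * \<delta> X {2}) \<noteq> 0"
      by (simp add: aug)
    then obtain X where X: "X \<in> scarf" "\<mu> {2} {4} X * \<delta> X {2} \<noteq> 0"
      by (rule sum.not_neutral_contains_not_neutral)
    then have nz: "\<mu> {2} {4} X \<noteq> 0" and X2: "2 \<in> X" "card X = 2"
      using diff[of X "{2}"] v1[of 2] by auto
    from X2 obtain v where v: "X = {2, v}" "v \<noteq> 2"
      by (auto simp: card_2_iff)
    have "v < 5" using X v bnd by auto
    moreover have "mdvd (gen v) (mlcm (gen ` {2}) + mlcm (gen ` {4}))"
      using mdeg[of "{2}" "{4}" X v] v1 X nz v by auto
    ultimately have "v = 0"
      using v X(1) d24[of v] by (auto simp: scarf_def)
    with v nz show ?thesis by (simp add: insert_commute)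
  qed

  \<comment> \<open>Compare coefficients at \<open>02\<close> in the boundary of \<open>e\<^sub>0\<^sub>2 * e\<^sub>3\<close>: the products of \<open>e\<^sub>0\<close> and \<open>e\<^sub>2\<close> with \<open>e\<^sub>3\<close>
    do not involve \<open>e\<^sub>0\<^sub>2\<close>, so the term from the boundary of \<open>e\<^sub>3\<close> is not cancelled.\<close>
  have q: "\<mu> {0,2} {3} {0,2,3} \<noteq> 0"
  proof -
    have z: "(\<Sum>X\<in>scarf. \<delta> {0,2} X * \<mu> X {3} {0,2}) = 0"
    proof (rule sum.neutral, rule ballI, rule ccontr)
      fix X assume X: "X \<in> scarf" "\<delta> {0,2} X * \<mu> X {3} {0,2} \<noteq> 0"
      then have "X \<subseteq> {0,2}" "card X = 1"
        using diff[of "{0,2}" X] faces by auto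
      then have "X = {0} \<or> X = {2}"
        by (auto simp: card_1_singleton_iff)
      moreover have "mdvd (gen 0) (mlcm (gen ` X) + mlcm (gen ` {3}))"
        "mdvd (gen 2) (mlcm (gen ` X) + mlcm (gen ` {3}))"
        using mdeg[of X "{3}" "{0,2}"] X v1 faces by auto
      ultimately show False
        by (auto simp: mdvd_gen lookup_add lookup_mlcm less_4_cases lookup_gen)
    qed
    have "(\<Sum>X\<in>scarf. \<mu> {0,2} {3} X * \<delta> X {0,2}) = \<delta> {3} {}"
      using leibniz[of "{0,2}" "{3}" "{0,2}"] z by (simp add: v1 faces aug_sum unit)
    then have "(\<Sum>X\<in>scarf. \<mu> {0,2} {3} X * \<delta> X {0,2}) \<noteq> 0"
      by (simp add: aug)
    then obtain X where X: "X \<in> scarf" "\<mu> {0,2} {3} X * \<delta> X {0,2} \<noteq> 0"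
      by (rule sum.not_neutral_contains_not_neutral)
    then have nz: "\<mu> {0,2} {3} X \<noteq> 0" and X2: "{0,2} \<subseteq> X" "card X = 3"
      using diff[of X "{0,2}"] faces by auto
    have "card (X - {0,2}) = 1"
      using X2 finite_in_scarf[OF X(1)] by (simp add: card_Diff_subset)
    then obtain v where Xv: "X - {0,2} = {v}"
      by (auto simp: card_1_singleton_iff)
    have "X = {0,2} \<union> (X - {0,2})"
      using X2(1) by blast
    then have X3: "X = {0,2,v}"
      unfolding Xv by (simp add: insert_commute)
    have "v \<in> X - {0,2}"
      unfolding Xv by simp
    with X3 have v: "X = {0,2,v}" "v \<noteq> 0" "v \<noteq> 2"
      by simp_all
    have "v < 5" using X v bnd by auto
    moreover have "mdvd (gen v) (mlcm (gen ` {0,2}) + mlcm (gen ` {3}))"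
      using mdeg[of "{0,2}" "{3}" X v] v1 faces X nz v by auto
    ultimately have "v = 3"
      using v d023[of v] by auto
    with v nz show ?thesis by simp
  qed

  \<comment> \<open>The edge \<open>04\<close> of \<open>e\<^sub>2 * e\<^sub>4\<close> contributes nothing, since generator \<open>2\<close> does not divide the
    multidegree of \<open>e\<^sub>0\<^sub>4 * e\<^sub>3\<close>.\<close>
  have left: "(\<Sum>X\<in>scarf. \<mu> {2} {4} X * \<mu> X {3} {0,2,3}) = \<mu> {2} {4} {0,2} * \<mu> {0,2} {3} {0,2,3}"
  proof (rule pick[OF faces(2)], rule ccontr)
    fix X assume X: "X \<in> scarf" "X \<noteq> {0,2}" "\<mu> {2} {4} X * \<mu> X {3} {0,2,3} \<noteq> 0"
    have "card X = 2"
      using deg[of "{2}" "{4}" X] X v1 by auto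
    then obtain v w where vw: "X = {v, w}" "v < w"
      by (metis card_2_iff insert_commute neq_iff)
    have "v < 5" "w < 5" using X vw bnd by auto
    moreover have "mdvd (gen v) (mlcm (gen ` {2}) + mlcm (gen ` {4}))" "mdvd (gen w) (mlcm (gen ` {2}) + mlcm (gen ` {4}))"
      using mdeg[of "{2}" "{4}" X] v1 X vw by auto
    ultimately have "X = {0,4}"
      using vw X(1,2) d24[of v] d24[of w] by (auto simp: scarf_def)
    moreover have "mdvd (gen 2) (mlcm (gen ` X) + mlcm (gen ` {3}))"
      using mdeg[of X "{3}" "{0,2,3}" 2] X v1 faces by auto
    ultimately show False
      by (auto simp: mdvd_gen lookup_add lookup_mlcm less_4_cases lookup_gen)
  qed

  \<comment> \<open>Generator \<open>0\<close> does not divide the multidegree of \<open>e\<^sub>2 * e\<^sub>1\<^sub>3\<close>, nor generator \<open>3\<close> that of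
    \<open>e\<^sub>2 * e\<^sub>1\<^sub>4\<close>.\<close>
  have right: "(\<Sum>X\<in>scarf. \<mu> {4} {3} X * \<mu> {2} X {0,2,3}) = 0"
  proof (rule sum.neutral, rule ballI, rule ccontr)
    fix X assume X: "X \<in> scarf" "\<mu> {4} {3} X * \<mu> {2} X {0,2,3} \<noteq> 0"
    have "card X = 2"
      using deg[of "{4}" "{3}" X] X v1 by auto
    then obtain v w where vw: "X = {v, w}" "v < w"
      by (metis card_2_iff insert_commute neq_iff)
    have "v < 5" "w < 5" using X vw bnd by auto
    moreover have "mdvd (gen v) (mlcm (gen ` {4}) + mlcm (gen ` {3}))" "mdvd (gen w) (mlcm (gen ` {4}) + mlcm (gen ` {3}))"
      using mdeg[of "{4}" "{3}" X] v1 X vw by auto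
    ultimately have "X = {1,3} \<or> X = {1,4}"
      using vw X(1) d43[of v] d43[of w] by (auto simp: scarf_def)
    moreover have "mdvd (gen 0) (mlcm (gen ` {2}) + mlcm (gen ` X))" "mdvd (gen 3) (mlcm (gen ` {2}) + mlcm (gen ` X))"
      using mdeg[of "{2}" X "{0,2,3}"] X v1 faces by auto
    ultimately show False
      by (auto simp: mdvd_gen lookup_add lookup_mlcm less_4_cases lookup_gen)
  qed

  show False
    using assoc[of "{2}" "{4}" "{3}" "{0,2,3}"] p q left right by (simp add: v1 faces)
qed

theorem scarf_copy_not_dga:
  fixes X :: "'v labelled_complex"
  assumes iso: "cell_iso \<Phi> (labelled_simplicial scarf gen) X" and inc: "incidence_function X \<epsilon>"
  shows "\<not> admits_dga 4 (cellular_complex X \<epsilon> :: ('v set, 'k::field) graded_complex)"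
proof
  let ?F = "cellular_complex X \<epsilon> :: ('v set, 'k) graded_complex"
  assume "admits_dga 4 ?F"
  then obtain mul where dga: "dga_structure 4 ?F mul"
    by (auto simp: admits_dga_def)
  have inj: "inj_on \<Phi> scarf" and bas: "basis ?F = \<Phi> ` scarf"
    using iso by (auto simp: cell_iso_def bij_betw_def cellular_complex_def)
  have emp: "\<Phi> {} = {}"
    using iso by (simp add: cell_iso_def)
  have inb: "\<Phi> W \<in> basis ?F" if "W \<in> scarf" for W
    using that bas by simp
  have lab: "cell_label X (\<Phi> W) = mlcm (gen ` W)" if "W \<in> scarf" for W
    using iso that cell_label_simplicial[OF scarf_simplicial that] by (simp add: cell_iso_def)
  have rk: "rank X (\<Phi> W) = card W" if "W \<in> scarf" for W
    using iso that by (simp add: cell_iso_def)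
  have fin: "finite (basis ?F)"
    using bas finite_scarf by simp
  have "mlcm (gen ` W) \<in> exps 4" if "W \<in> scarf" for W
    using that finite_in_scarf gen_in_exps by (intro exps_mlcm) auto
  then have pol: "dmat ?F b c \<in> polys 4" if bc: "b \<in> basis ?F" "c \<in> basis ?F" for b c
  proof -
    obtain W where "W \<in> scarf" "b = \<Phi> W"
      using bc(1) unfolding bas by blast
    then have "cell_label X b \<in> exps 4"
      using lab \<open>\<And>W. W \<in> scarf \<Longrightarrow> mlcm (gen ` W) \<in> exps 4\<close> by simp
    then show ?thesis
      by (simp add: cellular_complex_def polys_0 polys_single exps_diff)
  qed
  have sum_basis: "sum f (basis ?F) = (\<Sum>W\<in>scarf. f (\<Phi> W))" for f :: "'v set \<Rightarrow> 'k mpoly"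
    using inj by (simp add: bas sum.reindex)
  have hdeg: "hdeg ?F (\<Phi> W) = card W" if "W \<in> scarf" for W
    using that rk by (simp add: cellular_complex_def)
  have dmat: "dmat ?F (\<Phi> A) (\<Phi> B) = (if facet_in (labelled_simplicial scarf gen) B A
      then Poly_Mapping.single (mlcm (gen ` A) - mlcm (gen ` B)) (of_int (\<epsilon> (\<Phi> A) (\<Phi> B))) else 0)"
    if "A \<in> scarf" "B \<in> scarf" for A B
    using that cell_iso_facet_in[OF iso, of A B] by (simp add: cellular_complex_def lab)
  have sgn: "of_int (\<epsilon> (\<Phi> A) (\<Phi> B)) \<noteq> (0::'k)" if "A \<in> scarf" "B \<in> scarf"
    "facet_in (labelled_simplicial scarf gen) B A" for A B
  proof -
    have "facet_in X (\<Phi> B) (\<Phi> A)"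
      using that cell_iso_facet_in[OF iso, of A B] by simp
    then have "\<epsilon> (\<Phi> A) (\<Phi> B) \<in> {1, -1}"
      using inc by (simp add: incidence_function_def)
    then show ?thesis by auto
  qed
  define \<mu> where "\<mu> A B C = mul (basis_el (\<Phi> A)) (basis_el (\<Phi> B)) (\<Phi> C)" for A B C
  show False
  proof (rule scarf_obstruction[of \<mu> "\<lambda>A B. dmat ?F (\<Phi> A) (\<Phi> B)"])
    fix A B C assume *: "A \<in> scarf" "B \<in> scarf" "C \<in> scarf" "\<mu> A B C \<noteq> 0"
    note supp = dga_product_support[OF dga inb[OF *(1)] inb[OF *(2)] *(4)[unfolded \<mu>_def]]
    show "card C = card A + card B"
      using supp(2) * by (simp add: hdeg)
    have le: "Poly_Mapping.lookup (mlcm (gen ` C)) i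
        \<le> Poly_Mapping.lookup (mlcm (gen ` A)) i + Poly_Mapping.lookup (mlcm (gen ` B)) i" for i
      using supp(3)[of i] * by (simp add: cellular_complex_def lab)
    fix v assume "v \<in> C"
    then have "mdvd (gen v) (mlcm (gen ` C))"
      using finite_in_scarf[OF *(3)] mdvd_mlcm_iff[of "gen ` C" "mlcm (gen ` C)"] mdvd_refl by auto
    moreover have "mdvd (mlcm (gen ` C)) (mlcm (gen ` A) + mlcm (gen ` B))"
      using le by (simp add: mdvd_def lookup_add)
    ultimately show "mdvd (gen v) (mlcm (gen ` A) + mlcm (gen ` B))"
      by (rule mdvd_trans)
  next
    fix A B C assume *: "A \<in> scarf" "B \<in> scarf" "C \<in> scarf"
    show "(\<Sum>X\<in>scarf. \<mu> A B X * dmat ?F (\<Phi> X) (\<Phi> C))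
        = (\<Sum>X\<in>scarf. dmat ?F (\<Phi> A) (\<Phi> X) * \<mu> X B C)
          + (-1) ^ card A * (\<Sum>X\<in>scarf. dmat ?F (\<Phi> B) (\<Phi> X) * \<mu> A X C)"
      using dga_leibniz[OF dga fin pol inb[OF *(1)] inb[OF *(2)] inb[OF *(3)]] *
      by (simp add: sum_basis \<mu>_def hdeg)
  next
    fix A B C D assume *: "A \<in> scarf" "B \<in> scarf" "C \<in> scarf" "D \<in> scarf"
    show "(\<Sum>X\<in>scarf. \<mu> A B X * \<mu> X C D) = (\<Sum>X\<in>scarf. \<mu> B C X * \<mu> A X D)"
      using dga_associativity[OF dga fin inb[OF *(1)] inb[OF *(2)] inb[OF *(3)], of "\<Phi> D"]
      by (simp add: sum_basis \<mu>_def)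
  next
    fix B C assume *: "B \<in> scarf" "C \<in> scarf"
    have "unit_el ?F = \<Phi> {}"
      by (simp add: cellular_complex_def emp)
    then show "\<mu> {} B C = (if C = B then 1 else 0)" "\<mu> B {} C = (if C = B then 1 else 0)"
      using dga_unit[OF dga inb[OF *(1)]] inj *
      by (auto simp: \<mu>_def basis_el_def inj_on_eq_iff)
  next
    fix A B assume "A \<in> scarf" "B \<in> scarf" "dmat ?F (\<Phi> A) (\<Phi> B) \<noteq> 0"
    then show "B \<subseteq> A \<and> card A = Suc (card B)"
      by (auto simp: dmat facet_in_def split: if_splits)
  next
    fix v :: nat assume "v < 5"
    then have f: "{v} \<in> scarf" "{} \<in> scarf" by (auto simp: scarf_def)
    then have "facet_in (labelled_simplicial scarf gen) {} {v}"
      by (auto simp: facet_in_def)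
    with sgn[OF f this] show "dmat ?F (\<Phi> {v}) (\<Phi> {}) \<noteq> 0"
      by (simp add: dmat f) (metis lookup_single_eq lookup_zero)
  qed
qed

section \<open>Simplicial complexes all of whose degree parts are cones\<close>

text \<open>The part of multidegree \<open>m\<close> of the cellular complex is the simplicial chain complex over
  \<open>k\<close> of the faces with label dividing \<open>m\<close>; \<open>coef lab f m\<close> is the chain that is the
  degree-\<open>m\<close> part of \<open>f\<close>.\<close>
definition coef :: "('v \<Rightarrow> expo) \<Rightarrow> ('v set \<Rightarrow> 'k::comm_ring_1 mpoly) \<Rightarrow> expo \<Rightarrow> 'v set \<Rightarrow> 'k" where
  "coef lab f m W = (if mdvd (mlcm (lab ` W)) m
     then Poly_Mapping.lookup (f W) (m - mlcm (lab ` W)) else 0)"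

locale labelled_simplicial_incidence =
  fixes K :: "'v set set" and lab :: "'v \<Rightarrow> expo" and n :: nat
    and \<epsilon> :: "'v set \<Rightarrow> 'v set \<Rightarrow> int"
  assumes simplicial: "abstract_simplicial_complex K"
    and labels: "\<And>v. {v} \<in> K \<Longrightarrow> lab v \<in> exps n"
    and incidence: "incidence_function (labelled_simplicial K lab) \<epsilon>"
begin

abbreviation X :: "'v labelled_complex" where "X \<equiv> labelled_simplicial K lab"

abbreviation L :: "'v set \<Rightarrow> expo" where "L W \<equiv> mlcm (lab ` W)"

lemma finite_K: "finite K" and empty_face: "{} \<in> K"
  using simplicial by (auto simp: abstract_simplicial_complex_def)

lemma finite_face: "W \<in> K \<Longrightarrow> finite W"
  using simplicial by (auto simp: abstract_simplicial_complex_def)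

lemma subface: "W \<in> K \<Longrightarrow> V \<subseteq> W \<Longrightarrow> V \<in> K"
  using simplicial by (auto simp: abstract_simplicial_complex_def)

lemma single_sum: "Poly_Mapping.single d (of_int (sum g S)) = (\<Sum>x\<in>S. Poly_Mapping.single d (of_int (g x)))"
  by (induction S rule: infinite_finite_induct) (auto simp: single_add)

lemma finite_vertices: "finite (\<Union>K)"
  using finite_K finite_face by blast

lemma L_mono: "W \<in> K \<Longrightarrow> V \<subseteq> W \<Longrightarrow> mdvd (L V) (L W)"
  using finite_face by (intro mlcm_mono) auto

lemma L_exps: "W \<in> K \<Longrightarrow> L W \<in> exps n"
  using finite_face subface labels by (intro exps_mlcm) auto

lemma L_insert_dvd: "finite W \<Longrightarrow> mdvd (L (insert v W)) m \<longleftrightarrow> mdvd (lab v) m \<and> mdvd (L W) m"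
  by (simp add: mdvd_mlcm_iff)

lemmas facet_iff = facet_in_simplicial[OF simplicial, where lab = lab]

lemma sign_cases: "v \<notin> V \<Longrightarrow> insert v V \<in> K \<Longrightarrow> \<epsilon> (insert v V) V = 1 \<or> \<epsilon> (insert v V) V = -1"
  using incidence by (auto simp: incidence_function_def facet_iff)

lemma square:
  assumes "a \<notin> E" "b \<notin> E" "a \<noteq> b" "insert a (insert b E) \<in> K"
  shows "\<epsilon> (insert a (insert b E)) (insert a E) * \<epsilon> (insert a E) E
    + \<epsilon> (insert a (insert b E)) (insert b E) * \<epsilon> (insert b E) E = 0"
proof -
  let ?C = "insert a (insert b E)"
  have down: "insert a E \<in> K" "insert b E \<in> K" "E \<in> K"
    using subface[OF assms(4)] by auto
  have "{D. facet_in X D ?C \<and> facet_in X E D} = {insert a E, insert b E}"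
    unfolding facet_iff using assms down by auto
  moreover have "card ?C = card E + 2"
    using assms finite_face[OF down(3)] by simp
  then have "(\<Sum>D | facet_in X D ?C \<and> facet_in X E D. \<epsilon> ?C D * \<epsilon> D E) = 0"
    using incidence assms(4) down(3) unfolding incidence_function_def by auto
  moreover have "insert a E \<noteq> insert b E"
    using assms by auto
  ultimately show ?thesis by simp
qed

lemma cellular_simps:
  fixes F :: "('v set, 'k::comm_ring_1) graded_complex"
  assumes "F = cellular_complex X \<epsilon>"
  shows "basis F = K" "hdeg F = card" "unit_el F = {}"
    "W \<in> K \<Longrightarrow> mdeg F W i = int (Poly_Mapping.lookup (L W) i)"
    "W \<in> K \<Longrightarrow> V \<in> K \<Longrightarrow> dmat F W V =
       (if facet_in X V W then Poly_Mapping.single (L W - L V) (of_int (\<epsilon> W V)) else 0)"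
  using assms by (simp_all add: cellular_complex_def cell_label_simplicial[OF simplicial])

text \<open>In a fixed multidegree the differential is the ordinary simplicial boundary. Summing
  over all vertices \<open>v\<close> outside \<open>V\<close> instead of the facet relation is possible because \<open>f\<close> vanishes on
  sets that are not faces.\<close>
lemma coef_bd:
  fixes f :: "'v set \<Rightarrow> 'k::comm_ring_1 mpoly"
  assumes f: "f \<in> total_module n (cellular_complex X \<epsilon>)" and V: "V \<in> K"
  shows "coef lab (bd (cellular_complex X \<epsilon>) f) m V
    = (\<Sum>v\<in>\<Union>K - V. of_int (\<epsilon> (insert v V) V) * coef lab f m (insert v V))"
proof (cases "mdvd (L V) m")
  case False
  have "coef lab f m (insert v V) = 0" if "v \<in> \<Union>K - V" for v
    using False finite_face[OF V] L_insert_dvd by (auto simp: coef_def)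
  with False show ?thesis by (simp add: coef_def)
next
  case True
  let ?F = "cellular_complex X \<epsilon> :: ('v set, 'k) graded_complex"
  note simps = cellular_simps[OF refl, where 'k = 'k]
  have summand: "Poly_Mapping.lookup (f W * dmat ?F W V) (m - L V)
      = (if facet_in X V W then of_int (\<epsilon> W V) * coef lab f m W else 0)" if W: "W \<in> K" for W
  proof (cases "facet_in X V W")
    case facet: True
    then have "V \<subseteq> W" by (auto simp: facet_in_def)
    then have VW: "mdvd (L V) (L W)" using L_mono[OF W] by blast
    have "mdvd (L W - L V) (m - L V) \<longleftrightarrow> mdvd (L W) m"
    proof
      assume "mdvd (L W - L V) (m - L V)"
      then obtain q where "m - L V = (L W - L V) + q" by (auto simp: mdvd_iff_ex)
      then have "m = L W + q"
        using mdvd_add_diff(1)[OF True] mdvd_add_diff(1)[OF VW] by (metis add.assoc)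
      then show "mdvd (L W) m" by (auto simp: mdvd_iff_ex)
    next
      assume "mdvd (L W) m"
      then show "mdvd (L W - L V) (m - L V)"
        using mdvd_diff_diff[OF VW, of m] by (metis add.commute mdvd_add_left)
    qed
    moreover have "m - L V - (L W - L V) = m - L W" if "mdvd (L W) m"
      using mdvd_diff_diff[OF VW that] by (metis add_diff_cancel_right')
    ultimately show ?thesis
      using facet by (simp add: simps(5)[OF W V] lookup_times_single coef_def)
  next
    case False
    then show ?thesis by (simp add: simps(5)[OF W V])
  qed
  have f0: "f W = 0" if "W \<notin> K" for W
    using f that by (simp add: total_module_def simps)
  have "coef lab (bd ?F f) m V = (\<Sum>W\<in>K. Poly_Mapping.lookup (f W * dmat ?F W V) (m - L V))"
    using True V by (simp add: coef_def bd_def simps lookup_sum)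
  also have "\<dots> = (\<Sum>W\<in>K. if facet_in X V W then of_int (\<epsilon> W V) * coef lab f m W else 0)"
    by (intro sum.cong) (auto simp: summand)
  also have "\<dots> = (\<Sum>W\<in>{W\<in>K. facet_in X V W}. of_int (\<epsilon> W V) * coef lab f m W)"
    by (simp add: sum.inter_filter finite_K)
  also have "\<dots> = (\<Sum>W\<in>(\<lambda>v. insert v V) ` (\<Union>K - V). of_int (\<epsilon> W V) * coef lab f m W)"
  proof (intro sum.mono_neutral_left ballI)
    show "finite ((\<lambda>v. insert v V) ` (\<Union>K - V))"
      using finite_vertices by simp
    show "{W \<in> K. facet_in X V W} \<subseteq> (\<lambda>v. insert v V) ` (\<Union>K - V)"
    proof
      fix W assume "W \<in> {W \<in> K. facet_in X V W}"
      then obtain v where "W \<in> K" "v \<notin> V" "W = insert v V" by (auto simp: facet_iff)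
      then show "W \<in> (\<lambda>v. insert v V) ` (\<Union>K - V)" by auto
    qed
    fix W assume W: "W \<in> (\<lambda>v. insert v V) ` (\<Union>K - V) - {W \<in> K. facet_in X V W}"
    then have "W \<notin> K" by (auto simp: facet_iff)
    then show "of_int (\<epsilon> W V) * coef lab f m W = 0"
      by (simp add: coef_def f0)
  qed
  also have "\<dots> = (\<Sum>v\<in>\<Union>K - V. of_int (\<epsilon> (insert v V) V) * coef lab f m (insert v V))"
    by (subst sum.reindex) (auto simp: inj_on_def)
  finally show ?thesis .
qed

lemma bd_bd:
  fixes f :: "'v set \<Rightarrow> 'k::comm_ring_1 mpoly"
  shows "bd (cellular_complex X \<epsilon>) (bd (cellular_complex X \<epsilon>) f) = 0"
proof
  fix E
  let ?F = "cellular_complex X \<epsilon> :: ('v set, 'k) graded_complex"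
  note simps = cellular_simps[OF refl, where 'k = 'k]
  have inner: "(\<Sum>D\<in>K. dmat ?F C D * dmat ?F D E) = 0" if CE: "C \<in> K" "E \<in> K" for C
  proof -
    let ?S = "{D. facet_in X D C \<and> facet_in X E D}"
    have "(\<Sum>D\<in>K. dmat ?F C D * dmat ?F D E)
        = (\<Sum>D\<in>K. if D \<in> ?S then Poly_Mapping.single (L C - L E) (of_int (\<epsilon> C D * \<epsilon> D E)) else 0)"
    proof (rule sum.cong[OF refl])
      fix D assume D: "D \<in> K"
      have "(L C - L D) + (L D - L E) = L C - L E" if "D \<in> ?S"
        using that CE D by (intro mdvd_diff_diff L_mono) (auto simp: facet_in_def)
      then show "dmat ?F C D * dmat ?F D E
          = (if D \<in> ?S then Poly_Mapping.single (L C - L E) (of_int (\<epsilon> C D * \<epsilon> D E)) else 0)"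
        using CE D by (auto simp: simps(5) mult_single)
    qed
    also have "\<dots> = (\<Sum>D\<in>?S. Poly_Mapping.single (L C - L E) (of_int (\<epsilon> C D * \<epsilon> D E)))"
    proof -
      have "K \<inter> ?S = ?S" by (auto simp: facet_in_def)
      then show ?thesis by (simp only: sum.inter_restrict[OF finite_K, symmetric])
    qed
    also have "\<dots> = Poly_Mapping.single (L C - L E) (of_int (\<Sum>D\<in>?S. \<epsilon> C D * \<epsilon> D E))"
      by (simp only: single_sum)
    also have "(\<Sum>D\<in>?S. \<epsilon> C D * \<epsilon> D E) = 0"
    proof (cases "?S = {}")
      case False
      then obtain D where "facet_in X D C" "facet_in X E D" by blast
      then have "E \<subseteq> C" "card C = card E + 2" by (auto simp: facet_in_def)
      then show ?thesis
        using incidence CE by (simp add: incidence_function_def)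
    next
      case True
      show ?thesis unfolding True by simp
    qed
    finally show ?thesis by simp
  qed
  show "bd ?F (bd ?F f) E = 0 E"
  proof (cases "E \<in> K")
    case True
    have "bd ?F (bd ?F f) E = (\<Sum>D\<in>K. (\<Sum>C\<in>K. f C * dmat ?F C D) * dmat ?F D E)"
      using True by (simp add: bd_def simps)
    also have "\<dots> = (\<Sum>C\<in>K. f C * (\<Sum>D\<in>K. dmat ?F C D * dmat ?F D E))"
      by (simp add: sum_distrib_left sum_distrib_right mult.assoc)
        (rule sum.swap)
    also have "\<dots> = 0"
      using inner True by simp
    finally show ?thesis by simp
  qed (simp add: bd_def simps)
qed

definition cone_apex :: "expo \<Rightarrow> 'v \<Rightarrow> bool" where
  "cone_apex m a \<longleftrightarrow> mdvd (lab a) m \<and> (\<forall>W\<in>K. mdvd (L W) m \<longrightarrow> insert a W \<in> K)"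

text \<open>In multidegree \<open>m\<close> this is the cone operator with apex \<open>a\<close>, which sends a face \<open>V\<close> without
  \<open>a\<close> to \<open>insert a V\<close> and kills the faces that contain \<open>a\<close>, up to incidence signs. The apex may
  depend on \<open>m\<close>, so the operator is linear over \<open>k\<close> but in general not over \<open>S\<close>; it is therefore written down
  coefficientwise.\<close>
definition cone_homotopy :: "('v set \<Rightarrow> 'k::comm_ring_1 mpoly) \<Rightarrow> 'v set \<Rightarrow> 'k mpoly" where
  "cone_homotopy f G = (if G \<in> K then Abs_poly_mapping (\<lambda>k.
     let a = SOME a. cone_apex (k + L G) a in
     if a \<in> G then of_int (\<epsilon> G (G - {a})) * coef lab f (k + L G) (G - {a}) else 0) else 0)"

lemma lookup_cone_homotopy:
  fixes f :: "'v set \<Rightarrow> 'k::comm_ring_1 mpoly"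
  assumes G: "G \<in> K"
  shows "Poly_Mapping.lookup (cone_homotopy f G) k = (let a = SOME a. cone_apex (k + L G) a in
     if a \<in> G then of_int (\<epsilon> G (G - {a})) * coef lab f (k + L G) (G - {a}) else 0)" (is "_ = ?h k")
    and "Poly_Mapping.keys (cone_homotopy f G) \<subseteq>
      (\<Union>V\<in>{V\<in>K. \<exists>a\<in>G. V = G - {a}}. (\<lambda>j. j + L V - L G) ` Poly_Mapping.keys (f V))"
proof -
  let ?B = "\<Union>V\<in>{V\<in>K. \<exists>a\<in>G. V = G - {a}}. (\<lambda>j. j + L V - L G) ` Poly_Mapping.keys (f V)"
  have supp: "{k. ?h k \<noteq> 0} \<subseteq> ?B"
  proof
    fix k assume "k \<in> {k. ?h k \<noteq> 0}"
    then have "?h k \<noteq> 0" by simp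
    then obtain a where a: "a \<in> G" and "of_int (\<epsilon> G (G - {a})) * coef lab f (k + L G) (G - {a}) \<noteq> 0"
      unfolding Let_def by meson
    then have nz: "coef lab f (k + L G) (G - {a}) \<noteq> 0" by auto
    let ?V = "G - {a}"
    let ?j = "k + L G - L ?V"
    have j: "?j \<in> Poly_Mapping.keys (f ?V)" and dv: "mdvd (L ?V) (k + L G)"
      using nz by (auto simp: coef_def in_keys_iff split: if_splits)
    have "k = ?j + L ?V - L G"
      using mdvd_add_diff(2)[OF dv] by simp
    with j a subface[OF G, of ?V] show "k \<in> ?B" by blast
  qed
  moreover have "finite ?B"
    using finite_K by auto
  ultimately have "finite {k. ?h k \<noteq> 0}"
    by (rule finite_subset)
  then show eq: "Poly_Mapping.lookup (cone_homotopy f G) k = ?h k" for k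
    unfolding cone_homotopy_def using G by simp
  show "Poly_Mapping.keys (cone_homotopy f G) \<subseteq> ?B"
    using supp by (auto simp only: in_keys_iff eq subset_iff mem_Collect_eq)
qed

lemma cone_homotopy_hpart:
  fixes f :: "'v set \<Rightarrow> 'k::comm_ring_1 mpoly"
  assumes f: "f \<in> hpart n (cellular_complex X \<epsilon>) i"
  shows "cone_homotopy f \<in> hpart n (cellular_complex X \<epsilon>) (Suc i)"
proof -
  note simps = cellular_simps[OF refl, where 'k = 'k]
  have pol: "cone_homotopy f G \<in> polys n" if G: "G \<in> K" for G
  proof -
    have "j + L V - L G \<in> exps n" if "V \<in> K" "j \<in> Poly_Mapping.keys (f V)" for V j
      using that f by (intro exps_diff exps_add L_exps) (auto simp: hpart_def total_module_def polys_def simps)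
    then show ?thesis
      using lookup_cone_homotopy(2)[OF G, of f] by (auto simp: polys_def)
  qed
  moreover have "card G = Suc i" if nz: "cone_homotopy f G \<noteq> 0" for G
  proof -
    have G: "G \<in> K" using nz by (auto simp: cone_homotopy_def split: if_splits)
    have "Poly_Mapping.keys (cone_homotopy f G) \<noteq> {}" using nz by simp
    then obtain a where a: "a \<in> G" "f (G - {a}) \<noteq> 0"
      using lookup_cone_homotopy(2)[OF G, of f] by fastforce
    then have "card (G - {a}) = i"
      using f by (auto simp: hpart_def simps)
    with a finite_face[OF G] show ?thesis
      using card_Suc_Diff1 by metis
  qed
  moreover have "cone_homotopy f G = 0" if "G \<notin> K" for G
    using that by (simp add: cone_homotopy_def)
  ultimately show ?thesis
    by (simp add: hpart_def total_module_def simps)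
qed

lemma coef_cone_homotopy:
  assumes "G \<in> K"
  shows "coef lab (cone_homotopy f) m G = (if mdvd (L G) m \<and> (SOME a. cone_apex m a) \<in> G
    then of_int (\<epsilon> G (G - {SOME a. cone_apex m a})) * coef lab f m (G - {SOME a. cone_apex m a}) else 0)"
proof (cases "mdvd (L G) m")
  case True
  then have "coef lab (cone_homotopy f) m G = Poly_Mapping.lookup (cone_homotopy f G) (m - L G)"
    by (simp add: coef_def)
  also have "\<dots> = (let a = SOME a. cone_apex m a in
      if a \<in> G then of_int (\<epsilon> G (G - {a})) * coef lab f m (G - {a}) else 0)"
    unfolding lookup_cone_homotopy(1)[OF assms] mdvd_add_diff(2)[OF True] ..
  finally show ?thesis
    using True by (simp add: Let_def)
qed (simp add: coef_def)

text \<open>In multidegrees that have an apex the cone operator \<open>h\<close> satisfies \<open>\<partial> h + h \<partial> = id\<close>, so cycles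
  are boundaries. At faces that avoid
  the apex this is immediate; at a face \<open>V\<close> containing it, the square axiom of incidence functions
  turns the coefficient of \<open>\<partial> (h f)\<close> at \<open>V\<close> into, up to sign, the coefficient of \<open>\<partial> f\<close> at
  \<open>V - {a}\<close> without its summand for \<open>V\<close>.\<close>
lemma bd_cone_homotopy:
  fixes f :: "'v set \<Rightarrow> 'k::comm_ring_1 mpoly"
  assumes f: "f \<in> hpart n (cellular_complex X \<epsilon>) i" and i: "i \<ge> 1"
    and cycle: "bd (cellular_complex X \<epsilon>) f = 0"
    and cones: "\<And>m v. {v} \<in> K \<Longrightarrow> mdvd (lab v) m \<Longrightarrow> \<exists>a. cone_apex m a"
  shows "bd (cellular_complex X \<epsilon>) (cone_homotopy f) = f"
proof
  let ?F = "cellular_complex X \<epsilon> :: ('v set, 'k) graded_complex"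
  let ?h = "cone_homotopy f"
  note simps = cellular_simps[OF refl, where 'k = 'k]
  have fM: "f \<in> total_module n ?F" and hM: "?h \<in> total_module n ?F"
    using f cone_homotopy_hpart[OF f] by (auto simp: hpart_def)
  have f0: "f W = 0" if "W \<notin> K" for W
    using fM that by (simp add: total_module_def simps)
  have key: "coef lab (bd ?F ?h) m V = coef lab f m V" if V: "V \<in> K" "mdvd (L V) m" for V m
  proof (cases "\<exists>v. {v} \<in> K \<and> mdvd (lab v) m")
    case False
    \<comment> \<open>No vertex label divides \<open>m\<close>, so the only face in this degree is the empty one, and \<open>f\<close> lives
      in positive homological degree.\<close>
    have "V = {}"
    proof (rule ccontr)
      assume "V \<noteq> {}"
      then obtain v where v: "v \<in> V" by blast
      then have "{v} \<in> K" "mdvd (L {v}) m"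
        using V subface mdvd_trans[OF L_mono[OF V(1), of "{v}"] V(2)] by auto
      with False show False by auto
    qed
    have "f {} = 0"
      using f i by (auto simp: hpart_def simps)
    moreover have "coef lab ?h m {v} = 0" for v
      using False hM by (auto simp: coef_def total_module_def simps)
    ultimately show ?thesis
      using coef_bd[OF hM V(1)] \<open>V = {}\<close> by (simp add: coef_def)
  next
    case True
    define a where "a = (SOME a. cone_apex m a)"
    have "cone_apex m a"
      unfolding a_def using True cones by (auto intro: someI_ex)
    then have am: "mdvd (lab a) m" and cone: "\<And>W. W \<in> K \<Longrightarrow> mdvd (L W) m \<Longrightarrow> insert a W \<in> K"
      by (auto simp: cone_apex_def)
    have h: "coef lab ?h m G = (if mdvd (L G) m \<and> a \<in> G
        then of_int (\<epsilon> G (G - {a})) * coef lab f m (G - {a}) else 0)" if "G \<in> K" for G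
      unfolding a_def by (rule coef_cone_homotopy[OF that])
    have h0: "coef lab ?h m G = 0" if "G \<notin> K" for G
      using that by (simp add: coef_def cone_homotopy_def)
    show ?thesis
    proof (cases "a \<in> V")
      case False
      let ?aV = "insert a V"
      have aV: "?aV \<in> K" "mdvd (L ?aV) m"
        using cone[OF V] V am L_insert_dvd[OF finite_face[OF V(1)]] by auto
      then have aU: "a \<in> \<Union>K - V" using False by auto
      have rest: "coef lab ?h m (insert v V) = 0" if "v \<in> \<Union>K - V - {a}" for v
        using False that h[of "insert v V"] h0[of "insert v V"] by (cases "insert v V \<in> K") auto
      have "coef lab (bd ?F ?h) m V
          = (\<Sum>v\<in>\<Union>K - V. of_int (\<epsilon> (insert v V) V) * coef lab ?h m (insert v V))"
        by (rule coef_bd[OF hM V(1)])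
      also have "\<dots> = of_int (\<epsilon> ?aV V) * coef lab ?h m ?aV"
        using rest by (subst sum.remove[OF _ aU]) (simp_all add: finite_vertices)
      also have "coef lab ?h m ?aV = of_int (\<epsilon> ?aV V) * coef lab f m V"
        using h[OF aV(1)] aV False by simp
      finally show ?thesis
        using sign_cases[OF False aV(1)] by auto
    next
      case a: True
      define E where "E = V - {a}"
      have V_eq: "V = insert a E" "a \<notin> E" and E: "E \<in> K"
        using a subface[OF V(1), of E] by (auto simp: E_def)
      have aU: "a \<in> \<Union>K - E" using V(1) a V_eq by auto
      have U: "\<Union>K - E - {a} = \<Union>K - V"
        using V_eq by auto
      have "0 = coef lab (bd ?F f) m E"
        by (simp add: cycle coef_def)
      also have "\<dots> = of_int (\<epsilon> V E) * coef lab f m V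
          + (\<Sum>v\<in>\<Union>K - V. of_int (\<epsilon> (insert v E) E) * coef lab f m (insert v E))"
        unfolding coef_bd[OF fM E] by (subst sum.remove[OF _ aU]) (simp_all add: finite_vertices U V_eq(1))
      finally have rel: "(\<Sum>v\<in>\<Union>K - V. of_int (\<epsilon> (insert v E) E) * coef lab f m (insert v E))
          = - (of_int (\<epsilon> V E) * coef lab f m V)"
        by (simp add: eq_neg_iff_add_eq_0 add.commute)
      have step: "of_int (\<epsilon> (insert v V) V) * coef lab ?h m (insert v V)
          = - of_int (\<epsilon> V E) * (of_int (\<epsilon> (insert v E) E) * coef lab f m (insert v E))"
        if v: "v \<in> \<Union>K - V" for v
      proof (cases "coef lab f m (insert v E) = 0")
        case True
        have "insert v V - {a} = insert v E"
          using v V_eq by auto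
        with True have "coef lab ?h m (insert v V) = 0"
          using h[of "insert v V"] h0[of "insert v V"] by (cases "insert v V \<in> K") auto
        with True show ?thesis by simp
      next
        case False
        then have vE: "insert v E \<in> K" "mdvd (L (insert v E)) m"
          using f0[of "insert v E"] by (cases "insert v E \<in> K"; auto simp: coef_def split: if_splits)+
        have vV: "insert v V = insert a (insert v E)" "insert v V - {a} = insert v E"
          using V_eq v by auto
        then have W: "insert v V \<in> K" "mdvd (L (insert v V)) m"
          using cone[OF vE] am vE L_insert_dvd[OF finite_face[OF vE(1)], of a m] by auto
        have hv: "coef lab ?h m (insert v V) = of_int (\<epsilon> (insert v V) (insert v E)) * coef lab f m (insert v E)"
          using h[OF W(1)] W(2) vV a by simp
        have "\<epsilon> (insert v V) V * \<epsilon> V E + \<epsilon> (insert v V) (insert v E) * \<epsilon> (insert v E) E = 0"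
          using square[of a E v] V_eq v W(1) vV(1) by auto
        moreover have "\<epsilon> (insert v V) (insert v E) = 1 \<or> \<epsilon> (insert v V) (insert v E) = -1"
          using sign_cases[of a "insert v E"] vV W(1) V_eq v by auto
        moreover have "\<epsilon> V E = 1 \<or> \<epsilon> V E = -1"
          using sign_cases[of a E] V_eq V(1) by auto
        \<comment> \<open>Multiply the square relation by two signs.\<close>
        ultimately have "\<epsilon> (insert v V) V * \<epsilon> (insert v V) (insert v E) = - \<epsilon> V E * \<epsilon> (insert v E) E"
          by auto
        then have "of_int (\<epsilon> (insert v V) V) * of_int (\<epsilon> (insert v V) (insert v E))
            = (- of_int (\<epsilon> V E) * of_int (\<epsilon> (insert v E) E) :: 'k)"
          by (metis of_int_minus of_int_mult)
        then show ?thesis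
          unfolding hv by (simp add: mult.assoc[symmetric])
      qed
      have "coef lab (bd ?F ?h) m V
          = (\<Sum>v\<in>\<Union>K - V. - of_int (\<epsilon> V E) * (of_int (\<epsilon> (insert v E) E) * coef lab f m (insert v E)))"
        using coef_bd[OF hM V(1), of m] step by simp
      also have "\<dots> = - of_int (\<epsilon> V E) * (- (of_int (\<epsilon> V E) * coef lab f m V))"
        by (simp only: sum_distrib_left[symmetric] rel)
      also have "\<dots> = coef lab f m V"
        using sign_cases[of a E] V_eq V(1) by auto
      finally show ?thesis .
    qed
  qed
  fix V
  show "bd ?F ?h V = f V"
  proof (cases "V \<in> K")
    case True
    show ?thesis
    proof (rule poly_mapping_eqI)
      fix k
      have "mdvd (L V) (k + L V)" "k + L V - L V = k"
        by (simp_all add: mdvd_def lookup_add)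
      with key[OF True, of "k + L V"]
      show "Poly_Mapping.lookup (bd ?F ?h V) k = Poly_Mapping.lookup (f V) k"
        by (simp add: coef_def)
    qed
  next
    case False
    then show ?thesis by (simp add: bd_def simps f0)
  qed
qed

lemma bd_at_empty_face:
  fixes f :: "'v set \<Rightarrow> 'k::comm_ring_1 mpoly"
  shows "bd (cellular_complex X \<epsilon>) f {} = (\<Sum>v | {v} \<in> K. f {v} * mon (lab v))"
proof -
  let ?F = "cellular_complex X \<epsilon> :: ('v set, 'k) graded_complex"
  note simps = cellular_simps[OF refl, where 'k = 'k]
  have "bd ?F f {} = (\<Sum>W\<in>K. f W * dmat ?F W {})"
    using empty_face by (simp add: bd_def simps)
  also have "\<dots> = (\<Sum>W\<in>(\<lambda>v. {v}) ` {v. {v} \<in> K}. f W * dmat ?F W {})"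
  proof (intro sum.mono_neutral_right ballI)
    fix W assume W: "W \<in> K - (\<lambda>v. {v}) ` {v. {v} \<in> K}"
    then have "\<not> facet_in X {} W" by (auto simp: facet_iff)
    with W empty_face show "f W * dmat ?F W {} = 0" by (simp add: simps)
  qed (auto simp: finite_K)
  also have "\<dots> = (\<Sum>v | {v} \<in> K. f {v} * dmat ?F {v} {})"
    by (subst sum.reindex) (auto simp: inj_on_def)
  also have "\<dots> = (\<Sum>v | {v} \<in> K. f {v} * mon (lab v))"
  proof (rule sum.cong[OF refl])
    fix v assume v: "v \<in> {v. {v} \<in> K}"
    then have "\<epsilon> {v} {} = 1" "facet_in X {} {v}"
      using incidence by (auto simp: incidence_function_def vertices_simplicial facet_iff)
    with v empty_face show "f {v} * dmat ?F {v} {} = f {v} * mon (lab v)"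
      by (simp add: simps mon_def)
  qed
  finally show ?thesis .
qed

lemma augmentation_image:
  assumes inj: "inj_on lab {v. {v} \<in> K}"
  shows "{bd (cellular_complex X \<epsilon>) f {} | f. f \<in> hpart n (cellular_complex X \<epsilon>) 1}
    = (ideal_of n (lab ` {v. {v} \<in> K}) :: 'k::comm_ring_1 mpoly set)"
proof (intro equalityI subsetI)
  let ?F = "cellular_complex X \<epsilon> :: ('v set, 'k) graded_complex"
  let ?V = "{v. {v} \<in> K}"
  note simps = cellular_simps[OF refl, where 'k = 'k]
  have finV: "finite ?V"
    by (rule finite_subset[OF _ finite_vertices]) auto
  {
    fix p assume "p \<in> {bd ?F f {} | f. f \<in> hpart n ?F 1}"
    then obtain f where f: "f \<in> hpart n ?F 1" and p: "p = bd ?F f {}" by blast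
    define q where "q a = f {inv_into ?V lab a}" for a
    have "p = (\<Sum>a\<in>lab ` ?V. q a * mon a)"
      unfolding p bd_at_empty_face using inj by (simp add: sum.reindex q_def inv_into_f_f)
    moreover have "q a \<in> polys n" if "a \<in> lab ` ?V" for a
      using f that inj by (auto simp: q_def hpart_def total_module_def simps inv_into_f_f)
    ultimately show "p \<in> ideal_of n (lab ` ?V)"
      unfolding ideal_of_def using finV by blast
  next
    fix p :: "'k mpoly" assume "p \<in> ideal_of n (lab ` ?V)"
    then obtain B q where B: "finite B" "B \<subseteq> lab ` ?V" and q: "\<And>a. a \<in> B \<Longrightarrow> q a \<in> polys n"
      and p: "p = (\<Sum>a\<in>B. q a * mon a)"
      by (auto simp: ideal_of_def)
    define f where "f W = (if \<exists>v. W = {v} \<and> W \<in> K \<and> lab v \<in> B then q (lab (the_elem W)) else 0)" for W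
    have "f \<in> hpart n ?F 1"
      using q by (auto simp: hpart_def total_module_def simps f_def polys_0 split: if_splits)
    moreover have "p = bd ?F f {}"
    proof -
      have "bd ?F f {} = (\<Sum>v\<in>?V. if lab v \<in> B then q (lab v) * mon (lab v) else 0)"
        unfolding bd_at_empty_face by (intro sum.cong) (auto simp: f_def)
      also have "\<dots> = (\<Sum>a\<in>lab ` ?V. if a \<in> B then q a * mon a else 0)"
        using inj by (simp add: sum.reindex)
      also have "\<dots> = (\<Sum>a\<in>B. q a * mon a)"
        using B finV by (subst sum.inter_restrict[symmetric]) (auto simp: Int_absorb1)
      finally show ?thesis using p by simp
    qed
    ultimately show "p \<in> {bd ?F f {} | f. f \<in> hpart n ?F 1}" by blast
  }
qed

text \<open>A special case of the Bayer-Sturmfels criterion, with acyclicity of the subcomplexes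
  of bounded label replaced by the stronger condition that they are cones.\<close>
theorem free_resolution_if_cones:
  assumes inj: "inj_on lab {v. {v} \<in> K}"
    and cones: "\<And>m v. {v} \<in> K \<Longrightarrow> mdvd (lab v) m \<Longrightarrow> \<exists>a. cone_apex m a"
  shows "free_resolution n (ideal_of n (lab ` {v. {v} \<in> K}))
    (cellular_complex X \<epsilon> :: ('v set, 'k::comm_ring_1) graded_complex)"
proof -
  let ?F = "cellular_complex X \<epsilon> :: ('v set, 'k) graded_complex"
  note simps = cellular_simps[OF refl, where 'k = 'k]
  have "mdeg ?F W i = 0" if "W \<in> K" "i \<ge> n" for W i
    using L_exps[OF that(1)] that by (simp add: simps exps_iff)
  moreover have "dmat ?F W V \<in> polys n \<and> (dmat ?F W V \<noteq> 0 \<longrightarrow> card W = Suc (card V)) \<and>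
      (\<forall>m\<in>Poly_Mapping.keys (dmat ?F W V). mdeg ?F W = (\<lambda>i. int (Poly_Mapping.lookup m i)) + mdeg ?F V)"
    if WV: "W \<in> K" "V \<in> K" for W V
  proof -
    have "mdeg ?F W = (\<lambda>i. int (Poly_Mapping.lookup (L W - L V) i)) + mdeg ?F V" if "V \<subseteq> W"
    proof
      fix i
      have "Poly_Mapping.lookup (L V) i \<le> Poly_Mapping.lookup (L W) i"
        using L_mono[OF WV(1) that] by (simp add: mdvd_def)
      then show "mdeg ?F W i = ((\<lambda>i. int (Poly_Mapping.lookup (L W - L V) i)) + mdeg ?F V) i"
        by (simp add: simps(4) WV lookup_minus)
    qed
    then show ?thesis
      using L_exps[OF WV(1)]
      by (auto simp: simps(5)[OF WV] polys_0 polys_single exps_diff facet_in_def split: if_splits)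
  qed
  ultimately have "free_complex n ?F"
    unfolding free_complex_def by (auto simp: simps(1,2) finite_K bd_bd)
  moreover have "{b \<in> basis ?F. hdeg ?F b = 0} = {unit_el ?F}"
    using empty_face finite_face by (auto simp: simps(1-3))
  moreover have "mdeg ?F (unit_el ?F) = 0"
    by (rule ext) (simp add: simps(3,4) empty_face)
  moreover have "\<exists>g\<in>hpart n ?F (Suc i). bd ?F g = f"
    if "i \<ge> 1" "f \<in> hpart n ?F i" "bd ?F f = 0" for i f
  proof
    show "cone_homotopy f \<in> hpart n ?F (Suc i)"
      by (rule cone_homotopy_hpart[OF that(2)])
    show "bd ?F (cone_homotopy f) = f"
      by (rule bd_cone_homotopy[OF that(2,1,3)]) (rule cones)
  qed
  ultimately show ?thesis
    unfolding free_resolution_def using augmentation_image[OF inj] by (simp add: simps(3))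
qed

end

lemma graded_iso_id: "graded_iso n F F (\<lambda>f. f)"
  using bij_betw_id[unfolded id_def] by (simp add: graded_iso_def)

section \<open>The monomial ideal and its minimal free resolution\<close>

definition scarf_ideal :: "'k::comm_ring_1 mpoly set" where
  "scarf_ideal = ideal_of 4 (gen ` {..<5})"

lemma mon_in_scarf_ideal:
  "a \<in> exps 4 \<Longrightarrow> (mon a :: 'k::comm_ring_1 mpoly) \<in> scarf_ideal \<longleftrightarrow> (\<exists>v<5. mdvd (gen v) a)"
  unfolding scarf_ideal_def by (subst single_in_ideal) (auto simp: gen_in_exps)

lemma monomial_ideal_scarf_ideal: "monomial_ideal 4 (scarf_ideal :: 'k::comm_ring_1 mpoly set)"
proof -
  have "(mon 0 :: 'k mpoly) \<in> polys 4"
    by (simp add: mon_def polys_1)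
  moreover have "(mon 0 :: 'k mpoly) \<notin> scarf_ideal"
    by (auto simp: mon_in_scarf_ideal exps_0 mdvd_gen less_4_cases lookup_gen less_5_cases)
  ultimately have "(scarf_ideal :: 'k mpoly set) \<noteq> polys 4" by blast
  then show ?thesis
    unfolding monomial_ideal_def using gen_in_exps
    by (intro conjI exI[of _ "gen ` {..<5}"]) (auto simp: scarf_ideal_def)
qed

lemma gen_antichain:
  assumes "v < 5" "w < 5" "mdvd (gen v) (gen w)"
  shows "v = w"
  using assms by (auto simp: less_5_cases mdvd_gen less_4_cases lookup_gen)

lemma mingens_scarf_ideal: "mingens 4 (scarf_ideal :: 'k::comm_ring_1 mpoly set) = gen ` {..<5}"
proof (intro equalityI subsetI)
  fix a assume "a \<in> mingens 4 (scarf_ideal :: 'k mpoly set)"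
  then have a: "a \<in> exps 4" "\<exists>v<5. mdvd (gen v) a"
    and min: "\<And>b. b \<in> exps 4 \<Longrightarrow> (mon b :: 'k mpoly) \<in> scarf_ideal \<Longrightarrow> mdvd b a \<Longrightarrow> b = a"
    by (auto simp: mingens_def mon_in_scarf_ideal)
  then obtain v where v: "v < 5" "mdvd (gen v) a" by blast
  have "(mon (gen v) :: 'k mpoly) \<in> scarf_ideal"
    using v(1) mdvd_refl by (auto simp: mon_in_scarf_ideal gen_in_exps)
  then have "gen v = a"
    using min gen_in_exps v(2) by blast
  with v(1) show "a \<in> gen ` {..<5}" by auto
next
  fix a assume "a \<in> gen ` {..<5}"
  then obtain v where v: "v < 5" "a = gen v" by auto
  have "b = a" if b: "b \<in> exps 4" "(mon b :: 'k mpoly) \<in> scarf_ideal" "mdvd b a" for b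
  proof -
    obtain w where w: "w < 5" "mdvd (gen w) b"
      using b by (auto simp: mon_in_scarf_ideal)
    then have "w = v"
      using gen_antichain[of w v] v mdvd_trans[OF w(2) b(3)] by simp
    with w v b show ?thesis using mdvd_antisym by blast
  qed
  then show "a \<in> mingens 4 (scarf_ideal :: 'k mpoly set)"
    using v mdvd_refl by (auto simp: mingens_def mon_in_scarf_ideal gen_in_exps)
qed

lemma scarf_facets:
  assumes "W \<in> scarf"
  shows "W \<subseteq> {0,1,2,3} \<or> W \<subseteq> {0,1,4}"
proof (cases "4 \<in> W")
  case True
  then have "W \<subseteq> {..<5} - {2,3}" using assms by (auto simp: scarf_def)
  moreover have "{..<5} - {2,3} \<subseteq> {0,1,4::nat}" by auto
  ultimately show ?thesis by (meson order_trans)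
next
  case False
  then have "W \<subseteq> {..<5} - {4}" using assms by (auto simp: scarf_def)
  moreover have "{..<5} - {4} \<subseteq> {0,1,2,3::nat}" by auto
  ultimately show ?thesis by (meson order_trans)
qed

lemma not_mdvd_mlcm:
  assumes "finite A" "\<And>a. a \<in> A \<Longrightarrow> Poly_Mapping.lookup a i < Poly_Mapping.lookup b i"
    and "0 < Poly_Mapping.lookup b i"
  shows "\<not> mdvd b (mlcm A)"
proof
  assume "mdvd b (mlcm A)"
  then have "Poly_Mapping.lookup b i \<le> Max (insert 0 ((\<lambda>a. Poly_Mapping.lookup a i) ` A))"
    by (metis assms(1) lookup_mlcm mdvd_def)
  moreover have "Max (insert 0 ((\<lambda>a. Poly_Mapping.lookup a i) ` A)) < Poly_Mapping.lookup b i"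
    using assms by (subst Max_less_iff) auto
  ultimately show False by simp
qed

text \<open>Within each of the two facets, every generator has a variable with a larger exponent than
  in all other generators of that facet. The index \<open>i\<close> in the proof is such a variable.\<close>
lemma scarf_label_strict:
  assumes W: "W \<in> scarf" and v: "v \<in> W"
  shows "\<not> mdvd (gen v) (mlcm (gen ` (W - {v})))"
proof -
  have "v < 5" using W v by (auto simp: scarf_def)
  then have "\<exists>i. 0 < Poly_Mapping.lookup (gen v) i \<and>
      (\<forall>w\<in>W - {v}. Poly_Mapping.lookup (gen w) i < Poly_Mapping.lookup (gen v) i)"
  proof (cases "W \<subseteq> {0,1,2,3}")
    case True
    define i :: nat where "i = (if v = 0 then 1 else if v = 1 then 2 else if v = 2 then 0 else 3)"
    have mem: "w \<in> {0,1,2,3}" if "w \<in> W" for w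
      using True that by (rule subsetD)
    have less: "Poly_Mapping.lookup (gen w) i < Poly_Mapping.lookup (gen v) i"
      if "v \<in> {0,1,2,3}" "w \<in> {0,1,2,3}" "w \<noteq> v" for w
      using that by (auto simp: i_def lookup_gen)
    have pos: "0 < Poly_Mapping.lookup (gen v) i" if "v \<in> {0,1,2,3}"
      using that by (auto simp: i_def lookup_gen)
    show ?thesis
    proof (intro exI[of _ i] conjI ballI)
      show "0 < Poly_Mapping.lookup (gen v) i"
        by (intro pos mem v)
      show "Poly_Mapping.lookup (gen w) i < Poly_Mapping.lookup (gen v) i" if "w \<in> W - {v}" for w
        using that by (intro less mem v) simp_all
    qed
  next
    case False
    then have "W \<subseteq> {0,1,4}" using scarf_facets[OF W] by simp
    define i :: nat where "i = (if v = 0 then 0 else if v = 1 then 3 else 1)"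
    have mem: "w \<in> {0,1,4}" if "w \<in> W" for w
      using \<open>W \<subseteq> {0,1,4}\<close> that by (rule subsetD)
    have less: "Poly_Mapping.lookup (gen w) i < Poly_Mapping.lookup (gen v) i"
      if "v \<in> {0,1,4}" "w \<in> {0,1,4}" "w \<noteq> v" for w
      using that by (auto simp: i_def lookup_gen)
    have pos: "0 < Poly_Mapping.lookup (gen v) i" if "v \<in> {0,1,4}"
      using that by (auto simp: i_def lookup_gen)
    show ?thesis
    proof (intro exI[of _ i] conjI ballI)
      show "0 < Poly_Mapping.lookup (gen v) i"
        by (intro pos mem v)
      show "Poly_Mapping.lookup (gen w) i < Poly_Mapping.lookup (gen v) i" if "w \<in> W - {v}" for w
        using that by (intro less mem v) simp_all
    qed
  qed
  then obtain i where "0 < Poly_Mapping.lookup (gen v) i"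
    "\<forall>w\<in>W - {v}. Poly_Mapping.lookup (gen w) i < Poly_Mapping.lookup (gen v) i" by blast
  then show ?thesis
    using finite_in_scarf[OF W] by (intro not_mdvd_mlcm[where i = i]) auto
qed

lemma scarf_vertices: "{v. {v} \<in> scarf} = {..<5}"
  by (auto simp: scarf_def)

interpretation scarf: labelled_simplicial_incidence scarf gen 4 simplicial_sign
  using scarf_simplicial gen_in_exps incidence_function_simplicial[OF scarf_simplicial]
  by unfold_locales auto

text \<open>The vertices \<open>0\<close> and \<open>1\<close> lie in both facets, so each of them is an apex as soon as its
  generator divides \<open>m\<close>. If neither does, then the generators dividing \<open>m\<close> include at most one of
  \<open>2, 4\<close> and at most one of \<open>3, 4\<close>, and they span a simplex.\<close>
lemma scarf_cones:
  assumes "v < 5" "mdvd (gen v) m"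
  shows "\<exists>a. scarf.cone_apex m a"
proof -
  have vert: "w < 5 \<and> mdvd (gen w) m" if "W \<in> scarf" "mdvd (mlcm (gen ` W)) m" "w \<in> W" for W w
    using that finite_in_scarf[OF that(1)] by (auto simp: scarf_def mdvd_mlcm_iff)
  have m0: "mdvd (gen 0) m" if "mdvd (gen 2) m" "mdvd (gen 4) m"
    using that by (auto simp: mdvd_gen less_4_cases lookup_gen)
  have m1: "mdvd (gen 1) m" if "mdvd (gen 3) m" "mdvd (gen 4) m"
    using that by (auto simp: mdvd_gen less_4_cases lookup_gen)
  consider "mdvd (gen 0) m" | "\<not> mdvd (gen 0) m" "mdvd (gen 1) m"
    | "\<not> mdvd (gen 0) m" "\<not> mdvd (gen 1) m" "mdvd (gen 2) m"
    | "\<not> mdvd (gen 1) m" "\<not> mdvd (gen 2) m" "mdvd (gen 3) m"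
    | "\<not> mdvd (gen 2) m" "\<not> mdvd (gen 3) m" "mdvd (gen 4) m"
    using assms by (auto simp: less_5_cases)
  then show ?thesis
  proof cases
    case 1
    then have "scarf.cone_apex m 0" unfolding scarf.cone_apex_def by (auto simp: scarf_def)
    then show ?thesis ..
  next
    case 2
    then have "scarf.cone_apex m 1" unfolding scarf.cone_apex_def by (auto simp: scarf_def)
    then show ?thesis ..
  next
    case 3
    then have "4 \<notin> W" if "W \<in> scarf" "mdvd (mlcm (gen ` W)) m" for W
      using m0 vert[OF that, of 4] by auto
    with 3 have "scarf.cone_apex m 2" unfolding scarf.cone_apex_def by (auto simp: scarf_def)
    then show ?thesis ..
  next
    case 4
    then have "4 \<notin> W" if "W \<in> scarf" "mdvd (mlcm (gen ` W)) m" for W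
      using m1 vert[OF that, of 4] by auto
    with 4 have "scarf.cone_apex m 3" unfolding scarf.cone_apex_def by (auto simp: scarf_def)
    then show ?thesis ..
  next
    case 5
    then have "2 \<notin> W \<and> 3 \<notin> W" if "W \<in> scarf" "mdvd (mlcm (gen ` W)) m" for W
      using vert[OF that, of 2] vert[OF that, of 3] by auto
    with 5 have "scarf.cone_apex m 4" unfolding scarf.cone_apex_def by (auto simp: scarf_def)
    then show ?thesis ..
  qed
qed

definition scarf_resolution :: "(nat set, 'k::comm_ring_1) graded_complex" where
  "scarf_resolution = cellular_complex (labelled_simplicial scarf gen) simplicial_sign"

lemma free_resolution_scarf:
  "free_resolution 4 (scarf_ideal :: 'k::comm_ring_1 mpoly set) scarf_resolution"
  using scarf.free_resolution_if_cones[where 'k = 'k] inj_gen scarf_cones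
  unfolding scarf_vertices scarf_ideal_def scarf_resolution_def by (auto simp: scarf_def)

lemma single_in_max_ideal:
  assumes "d \<in> exps n" "d \<noteq> 0"
  shows "Poly_Mapping.single d c \<in> (max_ideal n :: 'k::comm_ring_1 mpoly set)"
proof -
  obtain i where i: "i \<in> Poly_Mapping.keys d"
    using assms(2) by (metis ex_in_conv keys_eq_empty)
  let ?x = "Poly_Mapping.single i 1 :: expo"
  have "i < n" using assms(1) i by (auto simp: exps_def)
  have "mdvd ?x d"
    using i by (auto simp: mdvd_def lookup_single when_def in_keys_iff)
  then have "Poly_Mapping.single d c = Poly_Mapping.single (d - ?x) c * mon ?x"
    using mdvd_add_diff(2) by (simp add: mon_def mult_single)
  moreover have "Poly_Mapping.single (d - ?x) c \<in> polys n"
    using assms(1) by (simp add: polys_single exps_diff)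
  ultimately show ?thesis
    unfolding max_ideal_def ideal_of_def using \<open>i < n\<close>
    by (intro CollectI exI[of _ "{?x}"] exI[of _ "\<lambda>_. Poly_Mapping.single (d - ?x) c"]) auto
qed

lemma zero_in_max_ideal: "0 \<in> (max_ideal n :: 'k::comm_ring_1 mpoly set)"
  unfolding max_ideal_def ideal_of_def by (intro CollectI exI[of _ "{}"]) auto

lemma minimal_free_resolution_scarf:
  "minimal_free_resolution 4 (scarf_ideal :: 'k::comm_ring_1 mpoly set) scarf_resolution"
proof -
  note simps = scarf.cellular_simps[OF refl, where 'k = 'k, folded scarf_resolution_def]
  have "dmat (scarf_resolution :: (nat set, 'k) graded_complex) W V \<in> max_ideal 4"
    if WV: "W \<in> scarf" "V \<in> scarf" for W V
  proof (cases "facet_in (labelled_simplicial scarf gen) V W")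
    case True
    then obtain v where v: "v \<notin> V" "W = insert v V" by (auto simp: scarf.facet_iff)
    have "mlcm (gen ` W) - mlcm (gen ` V) \<noteq> 0"
    proof
      assume 0: "mlcm (gen ` W) - mlcm (gen ` V) = 0"
      have "mdvd (mlcm (gen ` V)) (mlcm (gen ` W))"
        using v scarf.L_mono[OF WV(1), of V] by blast
      with 0 have "mlcm (gen ` W) = mlcm (gen ` V)"
        using mdvd_add_diff(1) by fastforce
      moreover have "mdvd (gen v) (mlcm (gen ` W))"
        using scarf.L_mono[OF WV(1), of "{v}"] v by simp
      ultimately show False
        using scarf_label_strict[OF WV(1), of v] v by auto
    qed
    then show ?thesis
      using True scarf.L_exps[OF WV(1)] by (simp add: simps(5)[OF WV] single_in_max_ideal exps_diff)
  next
    case False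
    then show ?thesis by (simp add: simps(5)[OF WV] zero_in_max_ideal)
  qed
  then show ?thesis
    by (simp add: minimal_free_resolution_def free_resolution_scarf simps(1))
qed

lemma scarf_resolution_supported:
  "supported_on 4 (scarf_ideal :: 'k::comm_ring_1 mpoly set) scarf_resolution (labelled_simplicial scarf gen)"
  unfolding supported_on_def vertices_simplicial scarf_vertices labelled_simplicial_simps
  using scarf.incidence graded_iso_id gen_in_exps
  by (auto simp: scarf_ideal_def scarf_resolution_def)

lemma cell_iso_refl: "{} \<in> cells X \<Longrightarrow> cell_iso (\<lambda>C. C) X X"
  by (auto simp: cell_iso_def bij_betw_def)

section \<open>The Lyubeznik complex\<close>

definition gen_order :: "(expo \<times> expo) set" where
  "gen_order = {(gen v, gen w) | v w. v \<le> w \<and> w < 5}"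

lemma gen_order_iff:
  assumes "v < 5" "w < 5"
  shows "(gen v, gen w) \<in> gen_order \<longleftrightarrow> v \<le> w"
proof
  assume "(gen v, gen w) \<in> gen_order"
  then obtain v' w' where "gen v = gen v'" "gen w = gen w'" "v' \<le> w'" "w' < 5"
    by (auto simp: gen_order_def)
  moreover from this assms have "v = v'" "w = w'"
    by (auto intro: inj_onD[OF inj_gen])
  ultimately show "v \<le> w" by simp
next
  assume "v \<le> w"
  with assms show "(gen v, gen w) \<in> gen_order"
    by (auto simp: gen_order_def)
qed

lemma linear_order_gen_order: "linear_order_on (gen ` {..<5}) gen_order"
proof -
  have sub: "gen_order \<subseteq> gen ` {..<5} \<times> gen ` {..<5}"
    by (auto simp: gen_order_def)
  have "trans gen_order"
  proof (rule transI)
    fix x y z assume *: "(x, y) \<in> gen_order" "(y, z) \<in> gen_order"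
    then obtain u v w where "u < 5" "v < 5" "w < 5" "x = gen u" "y = gen v" "z = gen w"
      using sub by blast
    with * show "(x, z) \<in> gen_order" by (auto simp: gen_order_iff)
  qed
  moreover have "antisym gen_order"
  proof (rule antisymI)
    fix x y assume *: "(x, y) \<in> gen_order" "(y, x) \<in> gen_order"
    then obtain u v where "u < 5" "v < 5" "x = gen u" "y = gen v"
      using sub by blast
    with * show "x = y" by (auto simp: gen_order_iff)
  qed
  moreover have "refl_on (gen ` {..<5}) gen_order" "total_on (gen ` {..<5}) gen_order"
    by (auto simp: refl_on_def total_on_def gen_order_iff)
  ultimately show ?thesis
    using sub by (simp add: linear_order_on_def partial_order_on_def preorder_on_def)
qed

text \<open>A set containing \<open>2\<close> and \<open>4\<close> is excluded by the smaller generator \<open>0\<close>, one containing \<open>3\<close> and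
  \<open>4\<close> by generator \<open>1\<close>. Conversely, some variable (the index \<open>i\<close> in the proof) has a larger exponent in
  generator \<open>u\<close> than in all vertices of the Scarf face that come after \<open>u\<close>, so generator \<open>u\<close> does not
  divide their lcm.\<close>
lemma lyubeznik_faces_scarf:
  "lyubeznik_faces 4 (scarf_ideal :: 'k::comm_ring_1 mpoly set) gen_order = (`) gen ` scarf"
proof (intro equalityI subsetI)
  fix A assume "A \<in> lyubeznik_faces 4 (scarf_ideal :: 'k mpoly set) gen_order"
  then have A: "finite A" "A \<subseteq> gen ` {..<5}"
    and no: "\<And>m q. m \<in> A \<Longrightarrow> q \<in> gen ` {..<5} \<Longrightarrow> (q, m) \<in> gen_order \<Longrightarrow> q \<noteq> m \<Longrightarrow>
      \<not> mdvd q (mlcm {w \<in> A. (m, w) \<in> gen_order})"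
    by (auto simp: lyubeznik_faces_def mingens_scarf_ideal)
  obtain W where W: "W \<subseteq> {..<5}" "A = gen ` W"
    using A(2) by (auto simp: subset_image_iff)
  have no4: False if "4 \<in> W" "v \<in> W" "u < v" "v < 4"
    "\<And>m. mdvd (gen v) m \<Longrightarrow> mdvd (gen 4) m \<Longrightarrow> mdvd (gen u) m" for u v
  proof -
    let ?T = "{w \<in> A. (gen v, w) \<in> gen_order}"
    have "gen v \<in> ?T" "gen 4 \<in> ?T"
      using that W by (auto simp: gen_order_iff)
    then have "mdvd (gen v) (mlcm ?T)" "mdvd (gen 4) (mlcm ?T)"
      using A(1) mdvd_mlcm_iff[of ?T "mlcm ?T"] mdvd_refl by auto
    then have "mdvd (gen u) (mlcm ?T)" using that by blast
    moreover have "gen u \<noteq> gen v"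
      using inj_onD[OF inj_gen, of u v] that by auto
    ultimately show False
      using no[of "gen v" "gen u"] that W by (auto simp: gen_order_iff)
  qed
  have "2 \<notin> W \<and> 3 \<notin> W" if "4 \<in> W"
    using no4[OF that, of 2 0] no4[OF that, of 3 1] by (auto simp: mdvd_gen less_4_cases lookup_gen)
  with W show "A \<in> (`) gen ` scarf" by (auto simp: scarf_def)
next
  fix A assume "A \<in> (`) gen ` scarf"
  then obtain W where W: "W \<in> scarf" "A = gen ` W" by blast
  have W5: "W \<subseteq> {..<5}" using W(1) by (simp add: scarf_def)
  have "\<not> mdvd (gen u) (mlcm {w \<in> A. (gen v, w) \<in> gen_order})" if v: "v \<in> W" and u: "u < v" for u v
  proof -
    have v5: "v < 5" using v W5 by auto
    have T: "{w \<in> A. (gen v, w) \<in> gen_order} = gen ` {w \<in> W. v \<le> w}"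
      using W5 v5 unfolding W(2) by (auto simp: gen_order_iff subset_iff)
    define i :: nat where "i = (if u = 0 then (if 4 \<in> W then 0 else 1)
      else if u = 1 then (if 4 \<in> W then 3 else 2) else if u = 2 then 0 else 3)"
    have "Poly_Mapping.lookup (gen w) i < Poly_Mapping.lookup (gen u) i" if w: "w \<in> W" "v \<le> w" for w
    proof -
      have "w < 5" "4 \<in> W \<longrightarrow> w \<noteq> 2 \<and> w \<noteq> 3" "w = 4 \<longrightarrow> 4 \<in> W"
        using w(1) W(1) by (auto simp: scarf_def)
      moreover have "u < w" using u w(2) by simp
      ultimately show ?thesis
        unfolding less_5_cases i_def lookup_gen by (elim disjE) auto
    qed
    moreover have "0 < Poly_Mapping.lookup (gen u) i"
      using u v5 by (auto simp: i_def lookup_gen)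
    ultimately show ?thesis
      unfolding T using finite_in_scarf[OF W(1)] by (intro not_mdvd_mlcm[where i = i]) auto
  qed
  moreover have "u < v" if "(gen u, gen v) \<in> gen_order" "gen u \<noteq> gen v" "u < 5" "v < 5" for u v
    using that by (auto simp: gen_order_iff le_less)
  ultimately have "\<not> (\<exists>m\<in>A. \<exists>q\<in>gen ` {..<5}. (q, m) \<in> gen_order \<and> q \<noteq> m \<and>
      mdvd q (mlcm {w \<in> A. (m, w) \<in> gen_order}))"
    using W5 W(2) by (auto simp: subset_iff)
  then show "A \<in> lyubeznik_faces 4 (scarf_ideal :: 'k mpoly set) gen_order"
    using W W5 finite_in_scarf[OF W(1)] by (auto simp: lyubeznik_faces_def mingens_scarf_ideal)
qed

lemma cell_iso_lyubeznik:
  "cell_iso ((`) gen) (labelled_simplicial scarf gen)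
    (lyubeznik_complex 4 (scarf_ideal :: 'k::comm_ring_1 mpoly set) gen_order)"
proof -
  have inj: "inj_on gen W" if "W \<in> scarf" for W
    using that inj_gen by (auto simp: scarf_def intro: inj_on_subset)
  have sub: "gen ` V \<subseteq> gen ` W \<longleftrightarrow> V \<subseteq> W" if "V \<in> scarf" "W \<in> scarf" for V W
    using that inj_gen by (auto simp: scarf_def inj_on_image_subset_iff)
  have bij: "inj_on ((`) gen) scarf"
    using sub by (intro inj_onI) (metis subset_antisym order_refl)
  have down: "B \<in> (`) gen ` scarf" if AB: "A \<in> (`) gen ` scarf" "B \<subseteq> A" for A B
  proof -
    obtain W where "W \<in> scarf" "A = gen ` W" using AB by blast
    with AB obtain V where "V \<subseteq> W" "B = gen ` V" by (auto simp: subset_image_iff)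
    with \<open>W \<in> scarf\<close> scarf.subface show ?thesis by blast
  qed
  have simp: "abstract_simplicial_complex ((`) gen ` scarf)"
    unfolding abstract_simplicial_complex_def
    using finite_scarf scarf.empty_face finite_in_scarf down by blast
  have lab: "cell_label (labelled_simplicial ((`) gen ` scarf) (\<lambda>m. m)) (gen ` W)
      = cell_label (labelled_simplicial scarf gen) W" if "W \<in> scarf" for W
    using that cell_label_simplicial[OF simp, of "gen ` W" "\<lambda>m. m"]
      cell_label_simplicial[OF scarf_simplicial that, of gen] by simp
  have "\<exists>u\<in>{v. {v} \<in> scarf}. gen ` {u} = {v}" if v: "{v} \<in> (`) gen ` scarf" for v
  proof -
    obtain W where W: "W \<in> scarf" "{v} = gen ` W" using v by blast
    then obtain u where u: "u \<in> W" "gen u = v" by blast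
    with W(1) scarf.subface[of W "{u}"] show ?thesis by auto
  qed
  then show ?thesis
    unfolding lyubeznik_complex_def lyubeznik_faces_scarf cell_iso_def
    using bij sub lab scarf.empty_face card_image[OF inj]
    by (simp add: bij_betw_def vertices_simplicial)
qed

section \<open>Faces of convex hulls\<close>

definition pairing :: "nat \<Rightarrow> (nat \<Rightarrow> real) \<Rightarrow> (nat \<Rightarrow> real) \<Rightarrow> real" where
  "pairing n c x = (\<Sum>i<n. c i * x i)"

lemma pairing_add: "pairing n c (x + y) = pairing n c x + pairing n c y"
  by (simp add: pairing_def algebra_simps sum.distrib)

lemma pairing_diff: "pairing n c (x - y) = pairing n c x - pairing n c y"
  by (simp add: pairing_def algebra_simps sum_subtractf)

lemma pairing_scaleR: "pairing n c (r *\<^sub>R x) = r * pairing n c x"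
  by (simp add: pairing_def scaleR_fun_def sum_distrib_left mult.left_commute)

lemma pairing_zero: "pairing n c 0 = 0"
  by (simp add: pairing_def)

lemma convex_pairing_ge: "convex {x. \<beta> \<le> pairing n c x}"
proof (rule convexI)
  fix x y :: "nat \<Rightarrow> real" and u v :: real
  assume *: "x \<in> {x. \<beta> \<le> pairing n c x}" "y \<in> {x. \<beta> \<le> pairing n c x}" "0 \<le> u" "0 \<le> v" "u + v = 1"
  then have "u * \<beta> + v * \<beta> \<le> u * pairing n c x + v * pairing n c y"
    by (intro add_mono mult_left_mono) auto
  with * show "u *\<^sub>R x + v *\<^sub>R y \<in> {x. \<beta> \<le> pairing n c x}"
    by (simp add: pairing_add pairing_scaleR distrib_right[symmetric])
qed

lemma hull_pairing_ge:
  assumes "\<And>x. x \<in> S \<Longrightarrow> \<beta> \<le> pairing n c x" "x \<in> convex hull S"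
  shows "\<beta> \<le> pairing n c x"
proof -
  have "convex hull S \<subseteq> {x. \<beta> \<le> pairing n c x}"
    using assms(1) convex_pairing_ge by (intro hull_minimal) auto
  with assms(2) show ?thesis by auto
qed

lemma hull_pairing_eq:
  assumes "\<And>x. x \<in> S \<Longrightarrow> pairing n c x = \<beta>" "x \<in> convex hull S"
  shows "pairing n c x = \<beta>"
proof -
  have "convex {x. pairing n c x = \<beta>}"
    by (rule convexI) (simp add: pairing_add pairing_scaleR distrib_right[symmetric])
  then have "convex hull S \<subseteq> {x. pairing n c x = \<beta>}"
    using assms(1) by (intro hull_minimal) auto
  with assms(2) show ?thesis by auto
qed

text \<open>A convex combination on which the functional is minimal gives positive weight only to points
  where it is minimal. The proof phrases this as convexity of the set of points above the
  hyperplane which, if they lie on it, are in the smaller hull.\<close>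
lemma hull_supporting_face:
  assumes S: "\<And>x. x \<in> S \<Longrightarrow> \<beta> \<le> pairing n c x"
  shows "{x \<in> convex hull S. pairing n c x = \<beta>} = convex hull {x \<in> S. pairing n c x = \<beta>}"
proof
  let ?T = "{x \<in> S. pairing n c x = \<beta>}"
  let ?Q = "{x. \<beta> \<le> pairing n c x \<and> (pairing n c x = \<beta> \<longrightarrow> x \<in> convex hull ?T)}"
  have "convex ?Q"
  proof (rule convexI)
    fix x y :: "nat \<Rightarrow> real" and u v :: real
    assume x: "x \<in> ?Q" and y: "y \<in> ?Q" and uv: "0 \<le> u" "0 \<le> v" "u + v = 1"
    have ge: "0 \<le> u * (pairing n c x - \<beta>)" "0 \<le> v * (pairing n c y - \<beta>)"
      using x y uv by auto
    have val: "pairing n c (u *\<^sub>R x + v *\<^sub>R y) - \<beta>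
        = u * (pairing n c x - \<beta>) + v * (pairing n c y - \<beta>)"
    proof -
      have "\<beta> = u * \<beta> + v * \<beta>"
        using uv(3) by (simp add: distrib_right[symmetric])
      then show ?thesis
        by (simp add: pairing_add pairing_scaleR right_diff_distrib)
    qed
    moreover have "u *\<^sub>R x + v *\<^sub>R y \<in> convex hull ?T"
      if eq: "pairing n c (u *\<^sub>R x + v *\<^sub>R y) = \<beta>"
    proof -
      have zero: "u * (pairing n c x - \<beta>) = 0" "v * (pairing n c y - \<beta>) = 0"
        using val eq ge by linarith+
      consider "u = 0" | "v = 0" | "pairing n c x = \<beta>" "pairing n c y = \<beta>"
        using zero by auto
      then show ?thesis
      proof cases
        case 1
        then show ?thesis using y uv zero by auto
      next
        case 2
        then show ?thesis using x uv zero by auto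
      next
        case 3
        then have "x \<in> convex hull ?T" "y \<in> convex hull ?T" using x y by auto
        then show ?thesis by (rule convexD[OF convex_convex_hull _ _ uv])
      qed
    qed
    ultimately show "u *\<^sub>R x + v *\<^sub>R y \<in> ?Q"
      using ge by auto
  qed
  moreover have "S \<subseteq> ?Q"
    using S by (auto intro: hull_inc)
  ultimately have "convex hull S \<subseteq> ?Q"
    by (rule hull_minimal[rotated])
  then show "{x \<in> convex hull S. pairing n c x = \<beta>} \<subseteq> convex hull ?T"
    by auto
  have "convex hull ?T \<subseteq> convex hull S"
    by (rule hull_mono) auto
  then show "convex hull ?T \<subseteq> {x \<in> convex hull S. pairing n c x = \<beta>}"
    using hull_pairing_eq[of ?T n c \<beta>] by auto
qed

text \<open>If every vertex can be separated from the others by a functional constant on the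
  others, the points are affinely independent. Such functionals come for free when all subsets
  of the vertices are faces, and this avoids computing determinants.\<close>
lemma point_rank_simplex:
  fixes p :: "'a \<Rightarrow> nat \<Rightarrow> real"
  assumes fin: "finite W"
    and sep: "\<And>k. k \<in> W \<Longrightarrow> \<exists>c \<beta>. (\<forall>j\<in>W - {k}. pairing n c (p j) = \<beta>) \<and> \<beta> < pairing n c (p k)"
  shows "point_rank (convex hull (p ` W)) = card W"
proof (cases "W = {}")
  case True
  then show ?thesis by (simp add: point_rank_def)
next
  case False
  then obtain w where w: "w \<in> W" by blast
  let ?H = "convex hull (p ` W)"
  let ?D = "{x - y | x y. x \<in> ?H \<and> y \<in> ?H}"
  define B where "B = (\<lambda>j. p j - p w) ` (W - {w})"
  have pH: "p j \<in> ?H" if "j \<in> W" for j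
    using that by (intro hull_inc) auto
  have "convex {x. x - p w \<in> span B}"
  proof (rule convexI)
    fix x y :: "nat \<Rightarrow> real" and u v :: real
    assume *: "x \<in> {x. x - p w \<in> span B}" "y \<in> {x. x - p w \<in> span B}" "0 \<le> u" "0 \<le> v" "u + v = 1"
    have "u *\<^sub>R p w + v *\<^sub>R p w = p w"
      using *(5) by (simp add: scaleR_add_left[symmetric])
    moreover have "u *\<^sub>R (x - p w) + v *\<^sub>R (y - p w)
        = u *\<^sub>R x + v *\<^sub>R y - (u *\<^sub>R p w + v *\<^sub>R p w)"
      by (simp add: scaleR_diff_right)
    ultimately have "u *\<^sub>R x + v *\<^sub>R y - p w = u *\<^sub>R (x - p w) + v *\<^sub>R (y - p w)"
      by simp
    also have "\<dots> \<in> span B"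
      using * by (intro real_vector.span_add real_vector.span_scale) auto
    finally show "u *\<^sub>R x + v *\<^sub>R y \<in> {x. x - p w \<in> span B}" by simp
  qed
  moreover have "p ` W \<subseteq> {x. x - p w \<in> span B}"
  proof
    fix x assume "x \<in> p ` W"
    then obtain j where j: "j \<in> W" "x = p j" by auto
    show "x \<in> {x. x - p w \<in> span B}"
      using j by (cases "j = w") (auto simp: B_def real_vector.span_zero intro: real_vector.span_base)
  qed
  ultimately have "?H \<subseteq> {x. x - p w \<in> span B}"
    by (intro hull_minimal)
  then have diff: "x - p w \<in> span B" if "x \<in> ?H" for x
    using that by auto
  have "?D \<subseteq> span B"
  proof
    fix z assume "z \<in> ?D"
    then obtain x y where "z = x - y" "x \<in> ?H" "y \<in> ?H" by auto
    then have "z = (x - p w) - (y - p w)" "x - p w \<in> span B" "y - p w \<in> span B"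
      using diff by auto
    then show "z \<in> span B"
      using real_vector.span_diff by metis
  qed
  moreover have "B \<subseteq> ?D"
    using w pH by (auto simp: B_def)
  ultimately have span: "span ?D = span B"
    by (meson real_vector.span_minimal real_vector.span_mono real_vector.subspace_span subset_antisym)
  have ker: "p k - p w \<notin> span ((\<lambda>j. p j - p w) ` (W - {w} - {k}))" if k: "k \<in> W - {w}" for k
  proof
    let ?R = "(\<lambda>j. p j - p w) ` (W - {w} - {k})"
    obtain c \<beta> where c: "\<forall>j\<in>W - {k}. pairing n c (p j) = \<beta>" "\<beta> < pairing n c (p k)"
      using sep[of k] k by blast
    have "subspace {x. pairing n c x = 0}"
      by (auto simp: real_vector.subspace_def pairing_add pairing_scaleR pairing_zero)
    moreover have "?R \<subseteq> {x. pairing n c x = 0}"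
      using c(1) k w by (auto simp: pairing_diff)
    ultimately have "span ?R \<subseteq> {x. pairing n c x = 0}"
      by (intro real_vector.span_minimal)
    moreover have "pairing n c (p k - p w) \<noteq> 0"
      using c k w by (auto simp: pairing_diff)
    moreover assume "p k - p w \<in> span ?R"
    ultimately show False by auto
  qed
  have inj: "inj_on (\<lambda>j. p j - p w) (W - {w})"
  proof (rule inj_onI, rule ccontr)
    fix j k assume *: "j \<in> W - {w}" "k \<in> W - {w}" "p j - p w = p k - p w" "j \<noteq> k"
    then have "j \<in> W - {w} - {k}" by auto
    then have "p j - p w \<in> (\<lambda>j. p j - p w) ` (W - {w} - {k})"
      by (rule imageI)
    then have "p k - p w \<in> (\<lambda>j. p j - p w) ` (W - {w} - {k})"
      unfolding *(3) .
    from ker[OF *(2)] real_vector.span_base[OF this] show False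
      by (rule notE)
  qed
  have ind: "independent B"
    unfolding real_vector.dependent_def
  proof (rule notI, elim bexE)
    fix b assume b: "b \<in> B" "b \<in> span (B - {b})"
    then obtain k where k: "k \<in> W - {w}" "b = p k - p w" by (auto simp: B_def)
    have "B - {b} \<subseteq> (\<lambda>j. p j - p w) ` (W - {w} - {k})"
      using k by (auto simp: B_def)
    then have "span (B - {b}) \<subseteq> span ((\<lambda>j. p j - p w) ` (W - {w} - {k}))"
      by (rule real_vector.span_mono)
    with ker[OF k(1)] b(2) k(2) show False by auto
  qed
  have "dim ?D = dim (span B)"
    using real_vector.dim_span[of ?D] by (simp only: span)
  also have "\<dots> = card B"
    by (simp only: real_vector.dim_span real_vector.dim_eq_card_independent[OF ind])
  also have "card B = card W - 1"
    using w fin by (simp add: B_def card_image[OF inj])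
  finally have "dim ?D = card W - 1" .
  moreover have "card W > 0" "?H \<noteq> {}"
    using w fin pH card_gt_0_iff by auto
  ultimately show ?thesis
    by (simp add: point_rank_def)
qed

section \<open>The hull complex\<close>

lemma sum_less_4: "(\<Sum>i<4. f i) = f 0 + f 1 + f 2 + (f (3::nat) :: real)"
  by (simp add: numeral_eq_Suc)

abbreviation hull_vertex :: "real \<Rightarrow> nat \<Rightarrow> nat \<Rightarrow> real" where
  "hull_vertex t v \<equiv> tpoint 4 t (gen v)"

lemma pairing_hull_vertex:
  "pairing 4 c (hull_vertex t v) = c 0 + c 1 + c 2 + c 3 + (t - 1) *
    (if v = 0 then c 0 + c 1 else if v = 1 then c 2 + c 3 else if v = 2 then (t + 1) * c 0
     else if v = 3 then (t + 1) * c 3 else (t + 1) * (c 1 + c 2))"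
  by (simp add: pairing_def sum_less_4 tpoint_def lookup_gen algebra_simps power2_eq_square)

text \<open>Subtracting \<open>c\<^sub>0 + c\<^sub>1 + c\<^sub>2 + c\<^sub>3\<close> and dividing by \<open>t - 1\<close>, the values of the functional at the
  five vertices become \<open>c\<^sub>0 + c\<^sub>1\<close>, \<open>c\<^sub>2 + c\<^sub>3\<close>, \<open>(t + 1) c\<^sub>0\<close>, \<open>(t + 1) c\<^sub>3\<close> and \<open>(t + 1) (c\<^sub>1 + c\<^sub>2)\<close>.
  On each facet of the Scarf complex the coefficients can be chosen to give these the value \<open>1\<close>
  on a prescribed subset (for the facet \<open>014\<close>, a subset containing \<open>4\<close>) and \<open>2\<close> on the other
  vertices of the facet, and the vertices outside the
  facet then get a value larger than \<open>1\<close> because \<open>t + 1\<close> is large.\<close>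
lemma scarf_face_exposed:
  assumes W: "W \<in> scarf" and t: "t > 3"
  obtains c \<beta> where "\<forall>i<4. 0 < c i" and "\<forall>v\<in>W. pairing 4 c (hull_vertex t v) = \<beta>"
    and "\<forall>v<5. v \<notin> W \<longrightarrow> \<beta> < pairing 4 c (hull_vertex t v)"
proof (cases "4 \<in> W")
  case False
  let ?z = "\<lambda>v. if v \<in> W then 0 else 1 :: real"
  define c0 c3 where "c0 = (1 + ?z 2) / (t + 1)" and "c3 = (1 + ?z 3) / (t + 1)"
  define c where "c = (\<lambda>i::nat. if i = 0 then c0 else if i = 1 then 1 - c0 + ?z 0
    else if i = 2 then 1 - c3 + ?z 1 else c3)"
  have c03: "0 < c0" "c0 < 1/2" "0 < c3" "c3 < 1/2"
    using t by (auto simp: c0_def c3_def field_simps)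
  have mult: "(t + 1) * c0 = 1 + ?z 2" "(t + 1) * c3 = 1 + ?z 3"
    using t by (auto simp: c0_def c3_def)
  have c_vals: "c 0 = c0" "c 1 = 1 - c0 + ?z 0" "c 2 = 1 - c3 + ?z 1" "c 3 = c3"
    by (auto simp: c_def)
  let ?\<beta> = "c 0 + c 1 + c 2 + c 3 + (t - 1)"
  have val: "pairing 4 c (hull_vertex t v) = ?\<beta> + (t - 1) * ?z v" if "v < 4" for v
  proof -
    have "v = 0 \<or> v = 1 \<or> v = 2 \<or> v = 3" using that by auto
    then show ?thesis
      unfolding pairing_hull_vertex using mult c_vals by (auto simp: algebra_simps)
  qed
  have "4 * 1 < (t + 1) * (c 1 + c 2)"
    using t c03 by (intro mult_strict_mono) (auto simp: c_vals[unfolded One_nat_def])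
  then have "(t - 1) * 1 < (t - 1) * ((t + 1) * (c 1 + c 2))"
    using t by (intro mult_strict_left_mono) auto
  then have val4: "?\<beta> < pairing 4 c (hull_vertex t 4)"
    unfolding pairing_hull_vertex by simp
  show thesis
  proof (rule that[of c ?\<beta>]; intro allI ballI impI)
    fix i :: nat assume "i < 4"
    then show "0 < c i" using c03 by (auto simp: c_def)
  next
    fix v :: nat assume "v \<in> W"
    then have "v < 5" using W by (auto simp: scarf_def)
    with \<open>v \<in> W\<close> have "v < 4" using False by (cases "v = 4") auto
    with \<open>v \<in> W\<close> show "pairing 4 c (hull_vertex t v) = ?\<beta>" using val by simp
  next
    fix v :: nat assume "v < 5" "v \<notin> W"
    then show "?\<beta> < pairing 4 c (hull_vertex t v)"
      using val[of v] val4 t by (cases "v = 4") auto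
  qed
next
  case True
  let ?z = "\<lambda>v. if v \<in> W then 0 else 1 :: real"
  define e where "e = 1 / (2 * (t + 1))"
  define c where "c = (\<lambda>i::nat. if i = 0 then 1 - e + ?z 0 else if i = 1 then e
    else if i = 2 then e else 1 - e + ?z 1)"
  have e: "0 < e" "e < 1/2" and mult: "(t + 1) * (e + e) = 1"
    using t by (auto simp: e_def field_simps)
  have c_vals: "c 0 = 1 - e + ?z 0" "c 1 = e" "c 2 = e" "c 3 = 1 - e + ?z 1"
    by (auto simp: c_def)
  let ?\<beta> = "c 0 + c 1 + c 2 + c 3 + (t - 1)"
  have val: "pairing 4 c (hull_vertex t v) = ?\<beta> + (t - 1) * ?z v" if "v = 0 \<or> v = 1" for v
    unfolding pairing_hull_vertex using that by (elim disjE) (simp_all add: c_vals[unfolded One_nat_def] algebra_simps)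
  have val4: "pairing 4 c (hull_vertex t 4) = ?\<beta>"
    unfolding pairing_hull_vertex using mult by (simp add: c_vals[unfolded One_nat_def])
  have val23: "?\<beta> < pairing 4 c (hull_vertex t v)" if "v = 2 \<or> v = 3" for v
  proof -
    have "4 * (1/2) < (t + 1) * c 0" "4 * (1/2) < (t + 1) * c 3"
      using t e by (intro mult_strict_mono; simp add: c_vals)+
    then have "(t - 1) * 1 < (t - 1) * ((t + 1) * c 0)" "(t - 1) * 1 < (t - 1) * ((t + 1) * c 3)"
      using t by (intro mult_strict_left_mono; simp)+
    with that show ?thesis
      unfolding pairing_hull_vertex by auto
  qed
  have W23: "2 \<notin> W" "3 \<notin> W" using W True by (auto simp: scarf_def)
  show thesis
  proof (rule that[of c ?\<beta>]; intro allI ballI impI)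
    fix i :: nat assume "i < 4"
    then show "0 < c i" using e by (auto simp: c_def)
  next
    fix v :: nat assume "v \<in> W"
    then have "v < 5" using W by (auto simp: scarf_def)
    with \<open>v \<in> W\<close> have "v = 0 \<or> v = 1 \<or> v = 4" using W23 less_5_cases[of v] by auto
    with \<open>v \<in> W\<close> show "pairing 4 c (hull_vertex t v) = ?\<beta>" using val val4 by auto
  next
    fix v :: nat assume "v < 5" "v \<notin> W"
    then have "v = 0 \<or> v = 1 \<or> v = 2 \<or> v = 3" using True less_5_cases[of v] by auto
    with \<open>v \<notin> W\<close> show "?\<beta> < pairing 4 c (hull_vertex t v)"
      using val[of v] val23[of v] t by auto
  qed
qed

text \<open>If the minimum \<open>b\<close> of the normalised values is attained at \<open>2\<close> and \<open>4\<close>, then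
  \<open>c\<^sub>0 = c\<^sub>1 + c\<^sub>2 > c\<^sub>1\<close>, so the value \<open>c\<^sub>0 + c\<^sub>1\<close> at \<open>0\<close> is less than \<open>2 c\<^sub>0 < (t + 1) c\<^sub>0 = b\<close>. The case of \<open>3\<close> and
  \<open>4\<close> is symmetric.\<close>
lemma minimizers_in_scarf:
  assumes c: "\<forall>i<4. 0 < c i" and t: "t > 1"
    and min: "\<And>v. v < 5 \<Longrightarrow> \<beta> \<le> pairing 4 c (hull_vertex t v)"
  shows "{v. v < 5 \<and> pairing 4 c (hull_vertex t v) = \<beta>} \<in> scarf"
proof -
  let ?s = "c 0 + c 1 + c 2 + c 3"
  define b where "b = (\<beta> - ?s) / (t - 1)"
  have c': "0 < c 0" "0 < c 1" "0 < c 2" "0 < c 3"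
    using c by auto
  have ge: "b \<le> x \<longleftrightarrow> \<beta> \<le> ?s + (t - 1) * x" and eq: "x = b \<longleftrightarrow> ?s + (t - 1) * x = \<beta>" for x
    using t by (auto simp: b_def field_simps)
  have b0: "b \<le> c 0 + c 1" and b1: "b \<le> c 2 + c 3"
    using min[of 0] min[of 1] by (simp_all add: ge pairing_hull_vertex)
  have 2: "(t + 1) * c 0 = b" if "pairing 4 c (hull_vertex t 2) = \<beta>"
    using that by (simp add: eq pairing_hull_vertex)
  have 3: "(t + 1) * c 3 = b" if "pairing 4 c (hull_vertex t 3) = \<beta>"
    using that by (simp add: eq pairing_hull_vertex)
  have 4: "(t + 1) * (c 1 + c 2) = b" if "pairing 4 c (hull_vertex t 4) = \<beta>"
    using that unfolding eq pairing_hull_vertex by simp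
  have False if eqs: "(t + 1) * x = b" "(t + 1) * (c 1 + c 2) = b" and le: "b \<le> x + y"
    and y: "y < c 1 + c 2" and x: "0 < x" for x y
  proof -
    have "(t + 1) * x = (t + 1) * (c 1 + c 2)"
      using eqs by simp
    then have "x = c 1 + c 2"
      using t by simp
    then have "(t + 1) * x < 2 * x"
      using eqs le y by linarith
    with t x show False by simp
  qed
  from this[of "c 0" "c 1"] this[of "c 3" "c 2"] show ?thesis
    using 2 3 4 b0 b1 c' unfolding scarf_def by (auto simp: add.commute)
qed

definition hull_points :: "real \<Rightarrow> (nat \<Rightarrow> real) set" where
  "hull_points t = {tpoint 4 t a | a. a \<in> exps 4 \<and> (\<exists>v<5. mdvd (gen v) a)}"

lemma hull_polyhedron_scarf:
  "hull_polyhedron 4 (scarf_ideal :: 'k::comm_ring_1 mpoly set) t = convex hull hull_points t"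
proof -
  have "{tpoint 4 t a | a. a \<in> exps 4 \<and> (mon a :: 'k mpoly) \<in> scarf_ideal} = hull_points t"
    unfolding hull_points_def using mon_in_scarf_ideal by blast
  then show ?thesis
    by (simp add: hull_polyhedron_def)
qed

lemma hull_vertex_in_points: "v < 5 \<Longrightarrow> hull_vertex t v \<in> hull_points t"
  unfolding hull_points_def using gen_in_exps mdvd_refl by blast

lemma tpoint_inject:
  assumes "t > 1" "a \<in> exps n" "b \<in> exps n" "tpoint n t a = tpoint n t b"
  shows "a = b"
proof (rule poly_mapping_eqI)
  fix i
  have "tpoint n t a i = tpoint n t b i" using assms(4) by simp
  then show "Poly_Mapping.lookup a i = Poly_Mapping.lookup b i"
    using assms(1-3) by (cases "i < n") (auto simp: tpoint_def exps_iff)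
qed

lemma pairing_tpoint_mono:
  assumes c: "\<forall>i<n. 0 < c i" and t: "t > 1" and "mdvd a b"
  shows "pairing n c (tpoint n t a) \<le> pairing n c (tpoint n t b)"
    and "a \<in> exps n \<Longrightarrow> b \<in> exps n \<Longrightarrow> pairing n c (tpoint n t b) \<le> pairing n c (tpoint n t a) \<Longrightarrow> a = b"
proof -
  have le: "c i * tpoint n t a i \<le> c i * tpoint n t b i" if "i < n" for i
    using assms that by (auto simp: tpoint_def mdvd_def intro!: mult_left_mono power_increasing less_imp_le)
  then show *: "pairing n c (tpoint n t a) \<le> pairing n c (tpoint n t b)"
    unfolding pairing_def by (intro sum_mono) auto
  assume ab: "a \<in> exps n" "b \<in> exps n" and "pairing n c (tpoint n t b) \<le> pairing n c (tpoint n t a)"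
  with * have "(\<Sum>i<n. c i * tpoint n t b i - c i * tpoint n t a i) = 0"
    by (simp add: pairing_def sum_subtractf)
  then have eq: "c i * tpoint n t b i - c i * tpoint n t a i = 0" if "i < n" for i
    using le that by (subst (asm) sum_nonneg_eq_0_iff) auto
  have "tpoint n t a i = tpoint n t b i" for i
  proof (cases "i < n")
    case True
    then have "c i \<noteq> 0" using c by force
    with eq[OF True] show ?thesis by simp
  qed (simp add: tpoint_def)
  then show "a = b"
    by (intro tpoint_inject[OF t ab] ext)
qed

text \<open>For positive coefficients the functional increases strictly along divisibility, so the
  minimum over all monomials of the ideal is attained at generators only.\<close>
lemma hull_points_exposed:
  assumes c: "\<forall>i<4. 0 < c i" and t: "t > 1"
    and min: "\<And>v. v < 5 \<Longrightarrow> \<beta> \<le> pairing 4 c (hull_vertex t v)"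
  shows "x \<in> hull_points t \<Longrightarrow> \<beta> \<le> pairing 4 c x"
    and "{x \<in> hull_points t. pairing 4 c x = \<beta>}
      = hull_vertex t ` {v. v < 5 \<and> pairing 4 c (hull_vertex t v) = \<beta>}"
proof -
  show "\<beta> \<le> pairing 4 c x" if x: "x \<in> hull_points t" for x
  proof -
    obtain a v where "x = tpoint 4 t a" "v < 5" "mdvd (gen v) a"
      using x by (auto simp: hull_points_def)
    with min pairing_tpoint_mono(1)[OF c t] show ?thesis by (blast intro: order_trans)
  qed
  show "{x \<in> hull_points t. pairing 4 c x = \<beta>}
      = hull_vertex t ` {v. v < 5 \<and> pairing 4 c (hull_vertex t v) = \<beta>}" (is "?L = ?R")
  proof
    show "?R \<subseteq> ?L" using hull_vertex_in_points by auto
    show "?L \<subseteq> ?R"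
    proof
      fix x assume x: "x \<in> ?L"
      then obtain a v where a: "x = tpoint 4 t a" "a \<in> exps 4" "v < 5" "mdvd (gen v) a"
        by (auto simp: hull_points_def)
      have "pairing 4 c (tpoint 4 t a) \<le> pairing 4 c (hull_vertex t v)"
        using x a min[OF a(3)] by simp
      then have "gen v = a"
        using pairing_tpoint_mono(2)[OF c t a(4) gen_in_exps a(2)] by simp
      with x a show "x \<in> ?R" by auto
    qed
  qed
qed

definition unit_point :: "nat \<Rightarrow> nat \<Rightarrow> real" where
  "unit_point i = (\<lambda>j. if j = i then 1 else 0)"

text \<open>Multiplying a monomial of the ideal by a high power of a variable moves its point arbitrarily
  far in that coordinate direction, and the points in between are convex combinations.\<close>
lemma hull_upward_closed:
  assumes t: "t > 1" and i: "i < 4" and x: "x \<in> convex hull hull_points t" and s: "s \<ge> 0"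
  shows "x + s *\<^sub>R unit_point i \<in> convex hull hull_points t"
proof -
  let ?P = "convex hull hull_points t"
  let ?Q = "{x. \<forall>s\<ge>0. x + s *\<^sub>R unit_point i \<in> ?P}"
  have "convex ?Q"
  proof (rule convexI, rule CollectI, intro allI impI)
    fix x y :: "nat \<Rightarrow> real" and u v s :: real
    assume *: "x \<in> ?Q" "y \<in> ?Q" "0 \<le> u" "0 \<le> v" "u + v = 1" "0 \<le> s"
    have "u *\<^sub>R (s *\<^sub>R unit_point i) + v *\<^sub>R (s *\<^sub>R unit_point i) = s *\<^sub>R unit_point i"
      using *(5) by (simp add: scaleR_add_left[symmetric] distrib_right[symmetric])
    then have "u *\<^sub>R x + v *\<^sub>R y + s *\<^sub>R unit_point i = u *\<^sub>R (x + s *\<^sub>R unit_point i) + v *\<^sub>R (y + s *\<^sub>R unit_point i)"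
      by (simp only: scaleR_add_right add.assoc add.left_commute[of _ "v *\<^sub>R y"])
    also have "\<dots> \<in> ?P"
      using * by (intro convexD[OF convex_convex_hull]) auto
    finally show "u *\<^sub>R x + v *\<^sub>R y + s *\<^sub>R unit_point i \<in> ?P" .
  qed
  moreover have "hull_points t \<subseteq> ?Q"
  proof (rule subsetI, rule CollectI, intro allI impI)
    fix x and s :: real assume "x \<in> hull_points t" "0 \<le> s"
    then obtain a v where a: "x = tpoint 4 t a" "a \<in> exps 4" "v < 5" "mdvd (gen v) a"
      by (auto simp: hull_points_def)
    let ?l = "Poly_Mapping.lookup a i"
    obtain N where N: "t ^ ?l + s < t ^ N"
      using real_arch_pow[OF t] by blast
    have "?l < N"
    proof (rule ccontr)
      assume "\<not> ?l < N"
      then have "t ^ N \<le> t ^ ?l" using t by (intro power_increasing) auto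
      with N \<open>0 \<le> s\<close> show False by simp
    qed
    define b where "b = a + Poly_Mapping.single i (N - ?l)"
    have "b \<in> exps 4"
      using a(2) i by (auto simp: b_def exps_iff lookup_add lookup_single when_def)
    moreover have "mdvd (gen v) b"
      using mdvd_trans[OF a(4)] mdvd_add_left by (auto simp: b_def)
    ultimately have b: "tpoint 4 t b \<in> hull_points t"
      using a(3) by (auto simp: hull_points_def)
    define \<Delta> where "\<Delta> = t ^ N - t ^ ?l"
    have \<Delta>: "0 < \<Delta>" "s < \<Delta>"
      using N \<open>0 \<le> s\<close> by (auto simp: \<Delta>_def)
    have tb: "tpoint 4 t b = x + \<Delta> *\<^sub>R unit_point i"
      using \<open>?l < N\<close> i
      by (auto simp: fun_eq_iff a(1) tpoint_def b_def lookup_add lookup_single when_def unit_point_def \<Delta>_def scaleR_fun_def)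
    have "(1 - s / \<Delta>) *\<^sub>R x + (s / \<Delta>) *\<^sub>R tpoint 4 t b \<in> ?P"
      using \<Delta> \<open>0 \<le> s\<close> \<open>x \<in> hull_points t\<close> b
      by (intro convexD[OF convex_convex_hull] hull_inc) auto
    also have "(1 - s / \<Delta>) *\<^sub>R x + (s / \<Delta>) *\<^sub>R tpoint 4 t b = x + s *\<^sub>R unit_point i"
      using \<Delta>(1) by (simp add: tb fun_eq_iff scaleR_fun_def field_simps)
    finally show "x + s *\<^sub>R unit_point i \<in> ?P" .
  qed
  ultimately have "?P \<subseteq> ?Q" by (intro hull_minimal)
  with x s show ?thesis by blast
qed

lemma pairing_unit_point: "i < n \<Longrightarrow> pairing n c (unit_point i) = c i"
  by (simp add: pairing_def unit_point_def if_distrib cong: if_cong)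

text \<open>The polyhedron is closed under moving in the coordinate directions. A negative coefficient
  would make the functional decrease in its direction, and a zero coefficient would put a whole ray
  into the face.\<close>
lemma bounded_face_positive:
  assumes t: "t > 1" and ge: "\<And>x. x \<in> convex hull hull_points t \<Longrightarrow> \<beta> \<le> pairing 4 c x"
    and x: "x \<in> convex hull hull_points t" "pairing 4 c x = \<beta>"
    and bdd: "bounded_points 4 {x \<in> convex hull hull_points t. pairing 4 c x = \<beta>}"
    and i: "i < 4"
  shows "0 < c i"
proof -
  have val: "pairing 4 c (x + s *\<^sub>R unit_point i) = \<beta> + s * c i" for s
    using i x(2) by (simp add: pairing_add pairing_scaleR pairing_unit_point)
  have "\<beta> \<le> \<beta> + 1 * c i"
    using ge[OF hull_upward_closed[OF t i x(1), of 1]] val[of 1] by simp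
  moreover have "c i \<noteq> 0"
  proof
    assume "c i = 0"
    obtain B where B: "\<And>y. y \<in> convex hull hull_points t \<Longrightarrow> pairing 4 c y = \<beta> \<Longrightarrow> \<bar>y i\<bar> \<le> B"
      using bdd i by (auto simp: bounded_points_def)
    let ?s = "\<bar>B\<bar> + \<bar>x i\<bar> + 1"
    have mem: "x + ?s *\<^sub>R unit_point i \<in> convex hull hull_points t"
      by (rule hull_upward_closed[OF t i x(1)]) simp
    have "pairing 4 c (x + ?s *\<^sub>R unit_point i) = \<beta>"
      unfolding val using \<open>c i = 0\<close> by simp
    from B[OF mem this] show False
      by (simp add: unit_point_def scaleR_fun_def)
  qed
  ultimately show ?thesis by simp
qed

definition hull_cell :: "real \<Rightarrow> nat set \<Rightarrow> (nat \<Rightarrow> real) set" where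
  "hull_cell t W = convex hull (hull_vertex t ` W)"

lemma bounded_hull_cell:
  assumes t: "t > 1"
  shows "bounded_points 4 (hull_cell t W)"
proof -
  let ?Q = "{x :: nat \<Rightarrow> real. \<forall>i<4. 0 \<le> x i \<and> x i \<le> t ^ 2}"
  have "convex ?Q"
  proof (rule convexI)
    fix x y :: "nat \<Rightarrow> real" and u v :: real
    assume *: "x \<in> ?Q" "y \<in> ?Q" "0 \<le> u" "0 \<le> v" "u + v = 1"
    then show "u *\<^sub>R x + v *\<^sub>R y \<in> ?Q"
      by (auto simp: scaleR_fun_def intro!: convex_bound_le add_nonneg_nonneg)
  qed
  moreover have "hull_vertex t ` W \<subseteq> ?Q"
  proof -
    have "Poly_Mapping.lookup (gen v) i \<le> 2" for v i
      by (simp add: lookup_gen)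
    then show ?thesis
      using t by (auto simp: tpoint_def intro!: power_increasing)
  qed
  ultimately have "hull_cell t W \<subseteq> ?Q"
    unfolding hull_cell_def by (intro hull_minimal)
  then show ?thesis
    unfolding bounded_points_def by (intro exI[of _ "t ^ 2"]) (auto simp: subset_iff)
qed

lemma hull_complex_simps:
  "cells (hull_complex n I t) = {C. polyhedron_face n (hull_polyhedron n I t) C \<and> bounded_points n C}"
  "rank (hull_complex n I t) = point_rank"
  "label (hull_complex n I t) = (\<lambda>v. THE a. a \<in> exps n \<and> tpoint n t a = v)"
  by (simp_all add: hull_complex_def)

text \<open>The bound on \<open>t\<close> is what \<open>scarf_face_exposed\<close> asks for; it follows from \<open>t > 5!\<close>.\<close>
lemma cells_hull_complex:
  assumes t: "t > 3"
  shows "cells (hull_complex 4 (scarf_ideal :: 'k::comm_ring_1 mpoly set) t) = hull_cell t ` scarf"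
proof (intro equalityI subsetI)
  let ?P = "convex hull hull_points t"
  have t1: "t > 1" using t by simp
  {
    fix C assume "C \<in> cells (hull_complex 4 (scarf_ideal :: 'k mpoly set) t)"
    then obtain c \<beta> where ge: "\<And>x. x \<in> ?P \<Longrightarrow> \<beta> \<le> pairing 4 c x"
      and C: "C = {x \<in> ?P. pairing 4 c x = \<beta>}" and bdd: "bounded_points 4 C"
      by (auto simp: hull_complex_simps polyhedron_face_def hull_polyhedron_scarf pairing_def)
    show "C \<in> hull_cell t ` scarf"
    proof (cases "C = {}")
      case True
      then have "C = hull_cell t {}" by (simp add: hull_cell_def)
      then show ?thesis using scarf.empty_face by blast
    next
      case False
      then obtain x where x: "x \<in> ?P" "pairing 4 c x = \<beta>" using C by blast
      have c: "\<forall>i<4. 0 < c i"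
      proof (intro allI impI)
        fix i :: nat assume i: "i < 4"
        show "0 < c i"
          by (rule bounded_face_positive[OF t1 _ x bdd[unfolded C] i]) (rule ge)
      qed
      have S: "\<beta> \<le> pairing 4 c x" if "x \<in> hull_points t" for x
        using ge hull_inc[OF that] by blast
      let ?W = "{v. v < 5 \<and> pairing 4 c (hull_vertex t v) = \<beta>}"
      have min: "\<beta> \<le> pairing 4 c (hull_vertex t v)" if "v < 5" for v
        using S hull_vertex_in_points that by blast
      have "C = convex hull {x \<in> hull_points t. pairing 4 c x = \<beta>}"
        unfolding C by (rule hull_supporting_face) (rule S)
      also have "{x \<in> hull_points t. pairing 4 c x = \<beta>} = hull_vertex t ` ?W"
        by (rule hull_points_exposed(2)[OF c t1]) (rule min)
      finally have "C = hull_cell t ?W"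
        unfolding hull_cell_def .
      moreover have "?W \<in> scarf"
        by (rule minimizers_in_scarf[OF c t1]) (rule min)
      ultimately show ?thesis by blast
    qed
  next
    fix C assume "C \<in> hull_cell t ` scarf"
    then obtain W where W: "W \<in> scarf" and C: "C = hull_cell t W" by blast
    have "polyhedron_face 4 ?P C"
    proof (cases "W = {}")
      case True
      then show ?thesis
        unfolding polyhedron_face_def
        by (intro exI[of _ "\<lambda>_. 0"] exI[of _ "-1"]) (simp add: C hull_cell_def)
    next
      case False
      obtain c \<beta> where c: "\<forall>i<4. 0 < c i"
        and eq: "\<forall>v\<in>W. pairing 4 c (hull_vertex t v) = \<beta>"
        and less: "\<forall>v<5. v \<notin> W \<longrightarrow> \<beta> < pairing 4 c (hull_vertex t v)"
        by (rule scarf_face_exposed[OF W t])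
      have min: "\<beta> \<le> pairing 4 c (hull_vertex t v)" if "v < 5" for v
        using eq less that by (cases "v \<in> W") auto
      have "{v. v < 5 \<and> pairing 4 c (hull_vertex t v) = \<beta>} = W"
        using eq less W by (fastforce simp: scarf_def)
      moreover have "{x \<in> hull_points t. pairing 4 c x = \<beta>}
          = hull_vertex t ` {v. v < 5 \<and> pairing 4 c (hull_vertex t v) = \<beta>}"
        by (rule hull_points_exposed(2)[OF c t1]) (rule min)
      moreover have S: "\<beta> \<le> pairing 4 c x" if "x \<in> hull_points t" for x
        by (rule hull_points_exposed(1)[OF c t1 _ that]) (rule min)
      moreover have "{x \<in> ?P. pairing 4 c x = \<beta>} = convex hull {x \<in> hull_points t. pairing 4 c x = \<beta>}"
        by (rule hull_supporting_face) (rule S)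
      ultimately have "C = {x \<in> ?P. pairing 4 c x = \<beta>}"
        unfolding C hull_cell_def by simp
      moreover have "\<beta> \<le> pairing 4 c x" if "x \<in> ?P" for x
        by (rule hull_pairing_ge[OF _ that]) (rule S)
      ultimately show ?thesis
        unfolding polyhedron_face_def pairing_def by blast
    qed
    then show "C \<in> cells (hull_complex 4 (scarf_ideal :: 'k mpoly set) t)"
      using bounded_hull_cell[OF t1, of W] by (simp add: hull_complex_simps hull_polyhedron_scarf C)
  }
qed

text \<open>The functional that exposes the face \<open>W\<close> is larger at the other vertices, so the hull of \<open>W\<close>
  determines \<open>W\<close>.\<close>
lemma hull_vertex_in_cell:
  assumes t: "t > 3" and W: "W \<in> scarf" and v: "v < 5"
  shows "hull_vertex t v \<in> hull_cell t W \<longleftrightarrow> v \<in> W"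
proof
  assume mem: "hull_vertex t v \<in> hull_cell t W"
  obtain c \<beta> where "\<forall>i<4. 0 < c i"
    and eq: "\<forall>v\<in>W. pairing 4 c (hull_vertex t v) = \<beta>"
    and less: "\<forall>v<5. v \<notin> W \<longrightarrow> \<beta> < pairing 4 c (hull_vertex t v)"
    by (rule scarf_face_exposed[OF W t])
  have "pairing 4 c x = \<beta>" if "x \<in> hull_vertex t ` W" for x
    using that W eq by (auto simp: scarf_def)
  then have "pairing 4 c (hull_vertex t v) = \<beta>"
    using mem hull_pairing_eq unfolding hull_cell_def by blast
  with less v show "v \<in> W" by auto
next
  assume "v \<in> W"
  then show "hull_vertex t v \<in> hull_cell t W"
    unfolding hull_cell_def by (intro hull_inc) auto
qed

lemma cell_iso_hull:
  assumes t: "t > 3"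
  shows "cell_iso (hull_cell t) (labelled_simplicial scarf gen)
    (hull_complex 4 (scarf_ideal :: 'k::comm_ring_1 mpoly set) t)"
proof -
  let ?X = "hull_complex 4 (scarf_ideal :: 'k mpoly set) t"
  have t1: "t > 1" using t by simp
  have W5: "v < 5" if "W \<in> scarf" "v \<in> W" for W v
    using that by (auto simp: scarf_def)
  have sub: "hull_cell t V \<subseteq> hull_cell t W \<longleftrightarrow> V \<subseteq> W" if V: "V \<in> scarf" and W: "W \<in> scarf" for V W
  proof
    assume *: "hull_cell t V \<subseteq> hull_cell t W"
    show "V \<subseteq> W"
    proof
      fix v assume v: "v \<in> V"
      then have "v < 5" using W5[OF V] by blast
      with * v hull_vertex_in_cell[OF t V] hull_vertex_in_cell[OF t W] show "v \<in> W" by blast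
    qed
  next
    assume "V \<subseteq> W"
    then show "hull_cell t V \<subseteq> hull_cell t W"
      unfolding hull_cell_def by (intro hull_mono) auto
  qed
  have bij: "bij_betw (hull_cell t) scarf (cells ?X)"
    unfolding bij_betw_def cells_hull_complex[OF t]
  proof
    show "inj_on (hull_cell t) scarf"
      using sub by (intro inj_onI) (metis subset_antisym order_refl)
  qed simp
  have rank: "point_rank (hull_cell t W) = card W" if W: "W \<in> scarf" for W
    unfolding hull_cell_def
  proof (rule point_rank_simplex[where n = 4])
    show "finite W" by (rule finite_in_scarf[OF W])
    fix k assume k: "k \<in> W"
    have Wk: "W - {k} \<in> scarf" using W scarf.subface by blast
    obtain c \<beta> where "\<forall>i<4. 0 < c i"
      and eq: "\<forall>v\<in>W - {k}. pairing 4 c (hull_vertex t v) = \<beta>"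
      and less: "\<forall>v<5. v \<notin> W - {k} \<longrightarrow> \<beta> < pairing 4 c (hull_vertex t v)"
      by (rule scarf_face_exposed[OF Wk t])
    then show "\<exists>c \<beta>. (\<forall>j\<in>W - {k}. pairing 4 c (hull_vertex t j) = \<beta>) \<and> \<beta> < pairing 4 c (hull_vertex t k)"
      using W5[OF W] k by (intro exI[of _ c] exI[of _ \<beta>]) auto
  qed
  have single: "hull_cell t {v} = {hull_vertex t v}" for v
    by (simp add: hull_cell_def)
  have vert: "vertices ?X = hull_vertex t ` {..<5}"
  proof
    show "hull_vertex t ` {..<5} \<subseteq> vertices ?X"
    proof
      fix x assume "x \<in> hull_vertex t ` {..<5}"
      then obtain v where v: "v < 5" "x = hull_vertex t v" by auto
      then have "{v} \<in> scarf" by (auto simp: scarf_def)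
      then show "x \<in> vertices ?X"
        unfolding vertices_def cells_hull_complex[OF t] using single[of v] v(2) by blast
    qed
    show "vertices ?X \<subseteq> hull_vertex t ` {..<5}"
    proof
      fix x assume "x \<in> vertices ?X"
      then obtain W where W: "W \<in> scarf" "hull_cell t W = {x}"
        unfolding vertices_def cells_hull_complex[OF t] by blast
      then have "W \<noteq> {}" by (auto simp: hull_cell_def)
      then obtain v where v: "v \<in> W" by blast
      then have "hull_vertex t v \<in> hull_cell t W"
        using hull_vertex_in_cell[OF t W(1) W5[OF W(1) v]] by simp
      with W(2) W5[OF W(1) v] show "x \<in> hull_vertex t ` {..<5}" by auto
    qed
  qed
  have lab: "label ?X (hull_vertex t v) = gen v" for v
    unfolding hull_complex_simps
    using tpoint_inject[OF t1 _ gen_in_exps] gen_in_exps by (intro the_equality) auto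
  have cell_lab: "cell_label ?X (hull_cell t W) = cell_label (labelled_simplicial scarf gen) W"
    if W: "W \<in> scarf" for W
  proof -
    have "hull_cell t W \<inter> vertices ?X = hull_vertex t ` W"
      unfolding vert using hull_vertex_in_cell[OF t W] W5[OF W] by auto
    then show ?thesis
      using cell_label_simplicial[OF scarf_simplicial W, of gen] by (simp add: cell_label_def image_image lab)
  qed
  have "\<exists>u\<in>{v. {v} \<in> scarf}. hull_cell t {u} = {x}" if "x \<in> vertices ?X" for x
    using that unfolding vert scarf_vertices by (auto simp: single)
  then show ?thesis
    unfolding cell_iso_def vertices_simplicial
    using bij sub rank cell_lab scarf.empty_face by (simp add: hull_complex_simps(2) hull_cell_def)
qed

section \<open>Resolutions without DGA structure\<close>
theorem corollary5p3:
  shows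
    "(\<exists>n (I :: 'k::field mpoly set). monomial_ideal n I \<and>
       (\<forall>t :: real. t > fact (n + 1) \<longrightarrow>
          (\<exists>\<epsilon>. incidence_function (hull_complex n I t) \<epsilon>) \<and>
          (\<forall>\<epsilon>. incidence_function (hull_complex n I t) \<epsilon> \<longrightarrow>
             \<not> admits_dga n (cellular_complex (hull_complex n I t) \<epsilon> :: (_, 'k) graded_complex))))
   \<and> (\<exists>n (I :: 'k mpoly set) r. monomial_ideal n I \<and> linear_order_on (mingens n I) r \<and>
          (\<exists>\<epsilon>. incidence_function (lyubeznik_complex n I r) \<epsilon>) \<and>
          (\<forall>\<epsilon>. incidence_function (lyubeznik_complex n I r) \<epsilon> \<longrightarrow>
             \<not> admits_dga n (cellular_complex (lyubeznik_complex n I r) \<epsilon> :: (_, 'k) graded_complex)))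
   \<and> (\<exists>n (I :: 'k mpoly set) (F :: (nat set, 'k) graded_complex) (K :: nat set set) lab.
          monomial_ideal n I \<and> minimal_free_resolution n I F \<and>
          abstract_simplicial_complex K \<and> supported_on n I F (labelled_simplicial K lab) \<and>
          \<not> admits_dga n F)"
proof (intro conjI)
  let ?I = "scarf_ideal :: 'k mpoly set"
  show "\<exists>n (I :: 'k mpoly set). monomial_ideal n I \<and>
       (\<forall>t :: real. t > fact (n + 1) \<longrightarrow>
          (\<exists>\<epsilon>. incidence_function (hull_complex n I t) \<epsilon>) \<and>
          (\<forall>\<epsilon>. incidence_function (hull_complex n I t) \<epsilon> \<longrightarrow>
             \<not> admits_dga n (cellular_complex (hull_complex n I t) \<epsilon> :: (_, 'k) graded_complex)))"
  proof (intro exI[of _ "4::nat"] exI[of _ ?I] conjI allI impI)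
    show "monomial_ideal 4 ?I" by (rule monomial_ideal_scarf_ideal)
    fix t :: real assume "t > fact (4 + 1)"
    then have t: "t > 3" by (simp add: fact_numeral)
    show "\<exists>\<epsilon>. incidence_function (hull_complex 4 ?I t) \<epsilon>"
      by (rule cell_iso_incidence_function[OF cell_iso_hull[OF t] scarf.incidence])
    fix \<epsilon> assume "incidence_function (hull_complex 4 ?I t) \<epsilon>"
    then show "\<not> admits_dga 4 (cellular_complex (hull_complex 4 ?I t) \<epsilon> :: (_, 'k) graded_complex)"
      by (rule scarf_copy_not_dga[OF cell_iso_hull[OF t]])
  qed
  show "\<exists>n (I :: 'k mpoly set) r. monomial_ideal n I \<and> linear_order_on (mingens n I) r \<and>
          (\<exists>\<epsilon>. incidence_function (lyubeznik_complex n I r) \<epsilon>) \<and>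
          (\<forall>\<epsilon>. incidence_function (lyubeznik_complex n I r) \<epsilon> \<longrightarrow>
             \<not> admits_dga n (cellular_complex (lyubeznik_complex n I r) \<epsilon> :: (_, 'k) graded_complex))"
  proof (intro exI[of _ "4::nat"] exI[of _ ?I] exI[of _ gen_order] conjI allI impI)
    show "monomial_ideal 4 ?I" by (rule monomial_ideal_scarf_ideal)
    show "linear_order_on (mingens 4 ?I) gen_order"
      unfolding mingens_scarf_ideal by (rule linear_order_gen_order)
    show "\<exists>\<epsilon>. incidence_function (lyubeznik_complex 4 ?I gen_order) \<epsilon>"
      by (rule cell_iso_incidence_function[OF cell_iso_lyubeznik scarf.incidence])
    fix \<epsilon> assume "incidence_function (lyubeznik_complex 4 ?I gen_order) \<epsilon>"
    then show "\<not> admits_dga 4 (cellular_complex (lyubeznik_complex 4 ?I gen_order) \<epsilon> :: (_, 'k) graded_complex)"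
      by (rule scarf_copy_not_dga[OF cell_iso_lyubeznik])
  qed
  show "\<exists>n (I :: 'k mpoly set) (F :: (nat set, 'k) graded_complex) (K :: nat set set) lab.
          monomial_ideal n I \<and> minimal_free_resolution n I F \<and>
          abstract_simplicial_complex K \<and> supported_on n I F (labelled_simplicial K lab) \<and>
          \<not> admits_dga n F"
  proof (intro exI[of _ "4::nat"] exI[of _ ?I] exI[of _ scarf_resolution] exI[of _ scarf] exI[of _ gen] conjI)
    show "\<not> admits_dga 4 (scarf_resolution :: (nat set, 'k) graded_complex)"
      unfolding scarf_resolution_def
      by (rule scarf_copy_not_dga[OF cell_iso_refl scarf.incidence]) (simp add: scarf.empty_face)
  qed (rule monomial_ideal_scarf_ideal minimal_free_resolution_scarf scarf_simplicial
      scarf_resolution_supported)+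
qed

end
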